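(* Let $x_0\in(0,\pi)$ be such that, for some constant $d_0>0$, $|\sin(kx_0)|\ge d_0k^{-1}$ for all integers $k\ge1$. Let $T>0$, let $B\subset[0,T]$ be a measurable set of positive Lebesgue measure, and let $m>0$. Then there exists a constant $C>0$, that can depend only on $B$, $x_0$ and $m$, so that, for any $f\in H^2((0,\pi))$ with $\|f\|_{H^2((0,\pi))}\le m$, $$\|f\|_{L^2((0,\pi))}\le C\left(\left|\ln\|u_f(x_0,\cdot)\|_{L^\infty(B)}\right|^{-1}+\|u_f(x_0,\cdot)\|_{L^\infty(B)}\right),$$ where $u_f$ is the solution of the initial-boundary value problem $$(\partial_t-\partial_x^2)u=0\ \text{ in }(0,\pi)\times(0,+\infty),\qquad u(0,\cdot)=u(\pi,\cdot)=0,\qquad u(\cdot,0)=f.$$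
   Context: For $f\in L^2((0,\pi))$, $\widehat f_k=\frac2\pi\int_0^\pi f(x)\sin(kx)\,dx$, and the solution $u_f\in C([0,+\infty),L^2((0,\pi)))$ is $u_f(x,t)=\sum_{k\ge1}\widehat f_ke^{-k^2t}\sin(kx)$. For $\theta\ge0$ the paper uses the notation $H^\theta((0,\pi))=\{h\in L^2((0,\pi)):\ \sum_{k\ge1}\langle k\rangle^{2\theta}|\widehat h_k|^2<\infty\}$ (defined by sine coefficients), with norm $\|h\|_{H^\theta((0,\pi))}=\left(\sum_{k\ge1}\langle k\rangle^{2\theta}|\widehat h_k|^2\right)^{1/2}$, where $\langle k\rangle=(1+k^2)^{1/2}$. Convention: $|\ln y|^{-1}$ is read as $0$ when $y=0$ and as $+\infty$ when $y=1$. *)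

theory Defs
  imports "HOL-Analysis.Analysis" "HOL-Probability.Essential_Supremum"
begin

(* Elements of L^2((0,pi)) are represented by complex-valued functions on the real line that are
   Lebesgue measurable and square integrable on (0,pi); values outside (0,pi) play no role.
   Real-valued data are the special case of functions with values in the reals. *)

abbreviation leb_pi :: "real measure" where
  "leb_pi \<equiv> lebesgue_on {0<..<pi}"

definition L2_fun :: "(real \<Rightarrow> complex) \<Rightarrow> bool" where
  "L2_fun f \<longleftrightarrow> f \<in> borel_measurable leb_pi \<and>
     integrable leb_pi (\<lambda>x. (norm (f x))\<^sup>2)"

definition L2_norm :: "(real \<Rightarrow> complex) \<Rightarrow> real" where
  "L2_norm f = sqrt (integral\<^sup>L leb_pi (\<lambda>x. (norm (f x))\<^sup>2))"

definition sine_coeff :: "(real \<Rightarrow> complex) \<Rightarrow> nat \<Rightarrow> complex" where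
  "sine_coeff f k =
     (2 / pi) *\<^sub>R integral\<^sup>L leb_pi (\<lambda>x. sin (real k * x) *\<^sub>R f x)"

definition bracket :: "nat \<Rightarrow> real" where
  "bracket k = sqrt (1 + (real k)\<^sup>2)"

(* All series over integers k >= 1 are indexed by Suc k with k >= 0. *)

definition H_fun :: "real \<Rightarrow> (real \<Rightarrow> complex) \<Rightarrow> bool" where
  "H_fun \<theta> h \<longleftrightarrow> L2_fun h \<and>
     summable (\<lambda>k. bracket (Suc k) powr (2 * \<theta>) * (norm (sine_coeff h (Suc k)))\<^sup>2)"

definition H_norm :: "real \<Rightarrow> (real \<Rightarrow> complex) \<Rightarrow> real" where
  "H_norm \<theta> h =
     sqrt (\<Sum>k. bracket (Suc k) powr (2 * \<theta>) * (norm (sine_coeff h (Suc k)))\<^sup>2)"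

(* The series representation of the solution u_f of u_t = u_xx on (0,pi), u = 0 at x = 0 and x = pi,
   u(.,0) = f.  That it solves this problem is proved in heat_sol_pde, heat_sol_boundary,
   heat_sol_continuous and heat_sol_initial below; the last two are for f in H^2. *)

definition heat_sol :: "(real \<Rightarrow> complex) \<Rightarrow> real \<Rightarrow> real \<Rightarrow> complex" where
  "heat_sol f x t =
     (\<Sum>k. (exp (- (real (Suc k))\<^sup>2 * t) * sin (real (Suc k) * x)) *\<^sub>R sine_coeff f (Suc k))"

definition Linf_norm :: "real set \<Rightarrow> (real \<Rightarrow> complex) \<Rightarrow> ennreal" where
  "Linf_norm B g = esssup (lebesgue_on B) (\<lambda>t. ennreal (norm (g t)))"

(* |ln y|^(-1) on [0,\<infinity>], with the value 0 at y = 0 (and at y = \<infinity>) and \<infinity> at y = 1. *)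

definition inv_abs_ln :: "ennreal \<Rightarrow> ennreal" where
  "inv_abs_ln y =
     (if y = 0 \<or> y = \<infinity> then 0 else if y = 1 then \<infinity> else ennreal (inverse \<bar>ln (enn2real y)\<bar>))"

lemma has_vector_derivative_suminf:
  fixes f f' :: "nat \<Rightarrow> real \<Rightarrow> complex"
  assumes S: "open S" "convex S" "x \<in> S"
    and df: "\<And>n x. x \<in> S \<Longrightarrow> (f n has_vector_derivative f' n x) (at x)"
    and bd: "\<And>n x. x \<in> S \<Longrightarrow> norm (f' n x) \<le> K n" and K: "summable K"
    and sf: "\<And>x. x \<in> S \<Longrightarrow> summable (\<lambda>n. f n x)"
  shows "((\<lambda>x. \<Sum>n. f n x) has_vector_derivative (\<Sum>n. f' n x)) (at x)"
proof -
  have ul: "uniform_limit S (\<lambda>n x. \<Sum>i<n. f' i x) (\<lambda>x. \<Sum>n. f' n x) sequentially"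
    by (rule Weierstrass_m_test[OF bd K])
  have "\<exists>g. \<forall>x\<in>S. (\<lambda>n. f n x) sums (g x) \<and> (g has_derivative (\<lambda>h. h *\<^sub>R (\<Sum>n. f' n x))) (at x within S)"
  proof (rule has_derivative_series[OF S(2) _ _ S(3)])
    show "(f n has_derivative (\<lambda>h. h *\<^sub>R f' n x)) (at x within S)" if "x \<in> S" for n x
      using df[OF that] unfolding has_vector_derivative_def by (rule has_derivative_at_withinI)
    show "(\<lambda>n. f n x) sums (\<Sum>n. f n x)"
      using sf[OF S(3)] by (rule summable_sums)
    fix e :: real assume "e > 0"
    with ul have "\<forall>\<^sub>F n in sequentially. \<forall>x\<in>S. dist (\<Sum>i<n. f' i x) (\<Sum>n. f' n x) < e"
      by (auto simp: uniform_limit_iff)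
    then show "\<forall>\<^sub>F n in sequentially. \<forall>x\<in>S. \<forall>h. norm ((\<Sum>i<n. h *\<^sub>R f' i x) - h *\<^sub>R (\<Sum>n. f' n x)) \<le> e * norm h"
    proof (rule eventually_mono, intro ballI allI)
      fix n x h assume *: "\<forall>x\<in>S. dist (\<Sum>i<n. f' i x) (\<Sum>n. f' n x) < e" "x \<in> S"
      have "norm ((\<Sum>i<n. h *\<^sub>R f' i x) - h *\<^sub>R (\<Sum>n. f' n x)) = norm h * dist (\<Sum>i<n. f' i x) (\<Sum>n. f' n x)"
        unfolding dist_norm scaleR_sum_right[symmetric] scaleR_diff_right[symmetric] by simp
      also have "\<dots> \<le> norm h * e"
        using * by (intro mult_left_mono) (auto intro: less_imp_le)
      finally show "norm ((\<Sum>i<n. h *\<^sub>R f' i x) - h *\<^sub>R (\<Sum>n. f' n x)) \<le> e * norm h"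
        by (simp add: mult.commute)
    qed
  qed
  then obtain g where
    "\<forall>x\<in>S. (\<lambda>n. f n x) sums (g x) \<and> (g has_derivative (\<lambda>h. h *\<^sub>R (\<Sum>n. f' n x))) (at x within S)" ..
  then have g: "\<And>x. x \<in> S \<Longrightarrow> (\<lambda>n. f n x) sums (g x)"
    "\<And>x. x \<in> S \<Longrightarrow> (g has_derivative (\<lambda>h. h *\<^sub>R (\<Sum>n. f' n x))) (at x within S)"
    by simp_all
  have "(g has_derivative (\<lambda>h. h *\<^sub>R (\<Sum>n. f' n x))) (at x)"
    using g(2)[OF S(3)] unfolding at_within_open[OF S(3) S(1)] .
  then have "((\<lambda>x. \<Sum>n. f n x) has_derivative (\<lambda>h. h *\<^sub>R (\<Sum>n. f' n x))) (at x)"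
    by (rule has_derivative_transform_within_open[OF _ S(1) S(3)]) (rule sums_unique[OF g(1)])
  then show ?thesis by (simp add: has_vector_derivative_def)
qed

lemma L2_fun_integrable:
  assumes "L2_fun f" shows "integrable leb_pi f"
proof (rule Bochner_Integration.integrable_bound)
  show "integrable leb_pi (\<lambda>x. 1 + (norm (f x))\<^sup>2)"
    using assms unfolding L2_fun_def
    by (intro Bochner_Integration.integrable_add) (auto intro!: finite_measure.integrable_const finite_measureI simp: emeasure_restrict_space)
  show "f \<in> borel_measurable leb_pi" using assms by (simp add: L2_fun_def)
  have "y \<le> 1 + y\<^sup>2" for y :: real using zero_le_power2[of "y - 1/2"] by (simp add: power2_eq_square algebra_simps)
  then show "AE x in leb_pi. norm (f x) \<le> norm (1 + (norm (f x))\<^sup>2)"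
    by (intro AE_I2) (auto intro: order_trans[OF _ abs_ge_self])
qed

lemma sin_lebesgue_measurable:
  "(\<lambda>x. sin (a * x) :: real) \<in> borel_measurable (lebesgue_on S)"
  by (rule measurable_restrict_space1, rule measurable_completion) measurable

lemma integrable_sin_mult:
  fixes f :: "real \<Rightarrow> complex"
  assumes "integrable (lebesgue_on S) f"
  shows "integrable (lebesgue_on S) (\<lambda>x. sin (a * x) *\<^sub>R f x)"
proof (rule Bochner_Integration.integrable_bound[OF assms])
  show "(\<lambda>x. sin (a * x) *\<^sub>R f x) \<in> borel_measurable (lebesgue_on S)"
    using sin_lebesgue_measurable borel_measurable_integrable[OF assms]
    by (intro borel_measurable_scaleR)
  show "AE x in lebesgue_on S. norm (sin (a * x) *\<^sub>R f x) \<le> norm (f x)"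
    by (intro AE_I2) (simp add: mult_left_le_one_le)
qed

lemma sine_coeff_bounded:
  assumes "L2_fun f" obtains M where "M > 0" "\<And>k. norm (sine_coeff f k) \<le> M"
proof -
  let ?L = "leb_pi"
  have i: "integrable ?L f" using L2_fun_integrable[OF assms] .
  define A where "A = (2/pi) * (\<integral>x. norm (f x) \<partial>?L)"
  have A: "norm (sine_coeff f k) \<le> A" for k
  proof -
    have "norm (\<integral>x. sin (real k * x) *\<^sub>R f x \<partial>?L) \<le> (\<integral>x. norm (sin (real k * x) *\<^sub>R f x) \<partial>?L)"
      by (rule integral_norm_bound)
    also have "\<dots> \<le> (\<integral>x. norm (f x) \<partial>?L)"
      using i by (intro integral_mono integrable_norm integrable_sin_mult) (auto simp: mult_left_le_one_le)
    finally show ?thesis by (simp add: sine_coeff_def A_def divide_right_mono)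
  qed
  have "norm (sine_coeff f k) \<le> \<bar>A\<bar> + 1" for k
    using A[of k] by linarith
  moreover have "0 < \<bar>A\<bar> + 1" by simp
  ultimately show thesis using that[of "\<bar>A\<bar> + 1"] by simp
qed

lemma summable_Suc_power: "p \<le> 2 \<Longrightarrow> s > 0 \<Longrightarrow> summable (\<lambda>k. real (Suc k) ^ p * exp (- (real (Suc k))\<^sup>2 * s))"
proof (rule summable_comparison_test')
  assume p: "p \<le> 2" and s: "s > 0"
  have "summable (\<lambda>n. inverse ((real n)\<^sup>2))"
    by (rule inverse_power_summable) simp
  then have "summable (\<lambda>n. inverse ((real (Suc n))\<^sup>2))" by (subst summable_Suc_iff)
  then show "summable (\<lambda>n. (2 / s\<^sup>2) * inverse ((real (Suc n))\<^sup>2))" by (rule summable_mult)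
  fix n :: nat
  define N where "N = real (Suc n)"
  have N: "N \<ge> 1" by (simp add: N_def)
  have "1 + N\<^sup>2 * s + (N\<^sup>2 * s)\<^sup>2 / 2 \<le> exp (N\<^sup>2 * s)"
    using s by (intro exp_lower_Taylor_quadratic) auto
  then have "(N\<^sup>2 * s)\<^sup>2 / 2 \<le> exp (N\<^sup>2 * s)"
    using mult_nonneg_nonneg[OF zero_le_power2[of N] less_imp_le[OF s]] by linarith
  then have "exp (- N\<^sup>2 * s) \<le> inverse ((N\<^sup>2 * s)\<^sup>2 / 2)"
    unfolding mult_minus_left exp_minus using N s by (intro le_imp_inverse_le) auto
  then have "N ^ p * exp (- N\<^sup>2 * s) \<le> N ^ 2 * inverse ((N\<^sup>2 * s)\<^sup>2 / 2)"
    using N p by (intro mult_mono power_increasing) auto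
  also have "\<dots> = (2 / s\<^sup>2) * inverse (N\<^sup>2)"
    using N s by (simp add: field_simps power2_eq_square)
  finally show "norm (N ^ p * exp (- N\<^sup>2 * s)) \<le> (2 / s\<^sup>2) * inverse (N\<^sup>2)"
    using N by simp
qed

lemma heat_term_bound:
  assumes M: "\<And>k. norm (sine_coeff f k) \<le> M" and c: "\<bar>c\<bar> \<le> real (Suc k) ^ p" and t: "s \<le> t"
  shows "norm ((exp (- (real (Suc k))\<^sup>2 * t) * c) *\<^sub>R sine_coeff f (Suc k))
    \<le> M * (real (Suc k) ^ p * exp (- (real (Suc k))\<^sup>2 * s))"
proof -
  have "norm ((exp (- (real (Suc k))\<^sup>2 * t) * c) *\<^sub>R sine_coeff f (Suc k)) =
    (exp (- (real (Suc k))\<^sup>2 * t) * \<bar>c\<bar>) * norm (sine_coeff f (Suc k))" by (simp add: abs_mult)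
  also have "\<dots> \<le> (exp (- (real (Suc k))\<^sup>2 * s) * real (Suc k) ^ p) * M"
    using c t M by (intro mult_mono) auto
  finally show ?thesis by (simp add: mult_ac)
qed

lemma heat_sol_pde:
  assumes f: "L2_fun f" and t: "t > 0"
  obtains ux uxx where
    "\<And>x. ((\<lambda>x. heat_sol f x t) has_vector_derivative ux x) (at x)"
    "\<And>x. (ux has_vector_derivative uxx x) (at x)"
    "\<And>x. ((\<lambda>t. heat_sol f x t) has_vector_derivative uxx x) (at t)"
proof -
  obtain M where M: "\<And>k. norm (sine_coeff f k) \<le> M" using sine_coeff_bounded[OF f] by metis
  define s where "s = t / 2"
  have s: "0 < s" "s < t" using t by (auto simp: s_def)
  define N where "N = (\<lambda>k. real (Suc k))"
  have N: "N k \<ge> 1" for k by (simp add: N_def)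
  define K where "K = (\<lambda>p k. M * (N k ^ p * exp (- (N k)\<^sup>2 * s)))"
  have K: "summable (K p)" if "p \<le> 2" for p
    unfolding K_def N_def by (intro summable_mult summable_Suc_power that s)
  define T where "T = (\<lambda>r k c. (exp (- (N k)\<^sup>2 * r) * c) *\<^sub>R sine_coeff f (Suc k))"
  have bd: "norm (T r k c) \<le> K p k" if "\<bar>c\<bar> \<le> N k ^ p" "s \<le> r" for r k c p
    using heat_term_bound[OF M, of c k p s r] that by (simp add: T_def K_def N_def)
  have c: "\<bar>sin (y::real)\<bar> \<le> N k ^ 0" "\<bar>N k * cos y\<bar> \<le> N k ^ 1" "\<bar>- (N k)\<^sup>2 * sin y\<bar> \<le> N k ^ 2" for k y
    using N[of k] by (auto simp: abs_mult intro!: mult_left_le)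
  have h: "heat_sol f x r = (\<Sum>k. T r k (sin (N k * x)))" for x r
    by (simp add: heat_sol_def T_def N_def)
  have sm: "summable (\<lambda>k. T r k (c k))" if "\<And>k. \<bar>c k\<bar> \<le> N k ^ p" "p \<le> 2" "s \<le> r" for r c p
    by (rule summable_comparison_test'[OF K[OF that(2)]], rule bd[OF that(1) that(3)])
  show thesis
  proof
    show "((\<lambda>x. heat_sol f x t) has_vector_derivative (\<Sum>k. T t k (N k * cos (N k * x)))) (at x)" for x
      unfolding h
    proof (rule has_vector_derivative_suminf[where S = UNIV and K = "K 1"])
      show "((\<lambda>x. T t n (sin (N n * x))) has_vector_derivative T t n (N n * cos (N n * x))) (at x)" for n x
        unfolding T_def
        by (rule has_vector_derivative_eq_rhs, rule has_vector_derivative_scaleR) (auto intro!: derivative_eq_intros)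
      show "norm (T t n (N n * cos (N n * x))) \<le> K 1 n" for n x
        using bd[OF c(2)] s by simp
      show "summable (\<lambda>n. T t n (sin (N n * x)))" for x using sm[OF c(1)] s by simp
    qed (use K in auto)
    show "((\<lambda>x. \<Sum>k. T t k (N k * cos (N k * x))) has_vector_derivative (\<Sum>k. T t k (- (N k)\<^sup>2 * sin (N k * x)))) (at x)" for x
    proof (rule has_vector_derivative_suminf[where S = UNIV and K = "K 2"])
      show "((\<lambda>x. T t n (N n * cos (N n * x))) has_vector_derivative T t n (- (N n)\<^sup>2 * sin (N n * x))) (at x)" for n x
        unfolding T_def
        by (rule has_vector_derivative_eq_rhs, rule has_vector_derivative_scaleR) (auto intro!: derivative_eq_intros simp: power2_eq_square)
      show "norm (T t n (- (N n)\<^sup>2 * sin (N n * x))) \<le> K 2 n" for n x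
        using bd[OF c(3)] s by simp
      show "summable (\<lambda>n. T t n (N n * cos (N n * x)))" for x using sm[OF c(2)] s by simp
    qed (use K in auto)
    show "((\<lambda>t. heat_sol f x t) has_vector_derivative (\<Sum>k. T t k (- (N k)\<^sup>2 * sin (N k * x)))) (at t)" for x
      unfolding h
    proof (rule has_vector_derivative_suminf[where S = "{s<..}" and K = "K 2"])
      show "((\<lambda>r. T r n (sin (N n * x))) has_vector_derivative T r n (- (N n)\<^sup>2 * sin (N n * x))) (at r)" for n r
        unfolding T_def
        by (rule has_vector_derivative_eq_rhs, rule has_vector_derivative_scaleR) (auto intro!: derivative_eq_intros simp: power2_eq_square)
      show "norm (T r n (- (N n)\<^sup>2 * sin (N n * x))) \<le> K 2 n" if "r \<in> {s<..}" for n r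
        using bd[OF c(3), where r = r] that by simp
      show "summable (\<lambda>n. T r n (sin (N n * x)))" if "r \<in> {s<..}" for r using sm[OF c(1), where r = r] that by simp
    qed (use K s in auto)
  qed
qed

lemma heat_sol_boundary: "heat_sol f 0 t = 0" "heat_sol f pi t = 0"
proof -
  have "sin (real (Suc k) * pi) = 0" for k by (rule sin_npi)
  then show "heat_sol f 0 t = 0" "heat_sol f pi t = 0" by (simp_all add: heat_sol_def del: of_nat_Suc)
qed

lemma continuous_lebesgue_measurable:
  fixes g :: "real \<Rightarrow> 'a::euclidean_space"
  assumes "continuous_on UNIV g" shows "g \<in> borel_measurable (lebesgue_on S)"
  by (rule measurable_restrict_space1, rule measurable_completion)
    (use assms borel_measurable_continuous_onI in auto)

lemma integrable_bounded_mult: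
  fixes h :: "real \<Rightarrow> complex" and g :: "real \<Rightarrow> real"
  assumes h: "integrable M h" and g: "g \<in> borel_measurable M" "\<And>x. \<bar>g x\<bar> \<le> B"
  shows "integrable M (\<lambda>x. g x *\<^sub>R h x)"
proof (rule Bochner_Integration.integrable_bound)
  show "integrable M (\<lambda>x. B * norm (h x))" using h by simp
  show "(\<lambda>x. g x *\<^sub>R h x) \<in> borel_measurable M" using h g by measurable
  show "AE x in M. norm (g x *\<^sub>R h x) \<le> norm (B * norm (h x))"
  proof (intro AE_I2)
    fix x
    have "\<bar>g x\<bar> * norm (h x) \<le> B * norm (h x)" by (intro mult_right_mono g) simp
    then show "norm (g x *\<^sub>R h x) \<le> norm (B * norm (h x))" using abs_ge_self[of "B * norm (h x)"] by simp
  qed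
qed

lemma sine_complete:
  fixes h :: "real \<Rightarrow> complex"
  assumes h: "integrable leb_pi h"
    and z: "\<And>k::nat. k \<ge> 1 \<Longrightarrow> (\<integral>x. sin (real k * x) *\<^sub>R h x \<partial>leb_pi) = 0"
  shows "AE x in leb_pi. h x = 0"
proof -
  have ci: "integrable leb_pi (\<lambda>x. (sin (real k * x) * cos x ^ n) *\<^sub>R h x)" for k n
    by (intro integrable_bounded_mult[OF h, where B = 1] continuous_lebesgue_measurable continuous_intros)
      (auto simp: abs_mult power_abs intro!: mult_le_one power_le_one)
  have 1: "(\<integral>x. (sin (real k * x) * cos x ^ n) *\<^sub>R h x \<partial>leb_pi) = 0" for k n
  proof (induction n arbitrary: k)
    case 0
    then show ?case using z[of k] by (cases k) auto
  next
    case (Suc n)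
    show ?case
    proof (cases k)
      case (Suc j)
      have "(sin (real k * x) * cos x ^ Suc n) *\<^sub>R h x =
        (1/2) *\<^sub>R ((sin (real (Suc k) * x) * cos x ^ n) *\<^sub>R h x + (sin (real j * x) * cos x ^ n) *\<^sub>R h x)" for x
      proof -
        have "real k * x + x = real (Suc k) * x" "real k * x - x = real j * x"
          using Suc by (simp_all add: algebra_simps)
        then have "sin (real k * x) * cos x = (sin (real (Suc k) * x) + sin (real j * x)) / 2"
          by (simp only: sin_times_cos)
        then have "sin (real k * x) * cos x ^ Suc n = (1/2) * (sin (real (Suc k) * x) * cos x ^ n + sin (real j * x) * cos x ^ n)"
          unfolding power_Suc mult.assoc[symmetric] by (simp only:) (simp add: algebra_simps)
        then show ?thesis by (simp only:) (simp add: scaleR_add_left[symmetric])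
      qed
      then show ?thesis using ci[of "Suc k" n] ci[of j n] Suc.IH by (simp del: of_nat_Suc)
    qed simp
  qed
  have 2: "(\<integral>x. (sin x * c (cos x)) *\<^sub>R h x \<partial>leb_pi) = 0" if c: "continuous_on UNIV c" for c :: "real \<Rightarrow> real"
  proof -
    have "compact (c ` {-1..1})" by (intro compact_continuous_image continuous_on_subset[OF c]) auto
    then have "bounded (c ` {-1..1})" by (rule compact_imp_bounded)
    then obtain B where B: "\<And>y. y \<in> {-1..1} \<Longrightarrow> \<bar>c y\<bar> \<le> B"
      unfolding bounded_iff real_norm_def by (metis imageI)
    have ic: "integrable leb_pi (\<lambda>x. (sin x * c (cos x)) *\<^sub>R h x)"
    proof (intro integrable_bounded_mult[OF h, where B = "1 * B"] continuous_lebesgue_measurable continuous_intros)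
      show "continuous_on UNIV (\<lambda>x. c (cos x))" by (intro continuous_on_compose2[OF c] continuous_intros) auto
      show "\<bar>sin x * c (cos x)\<bar> \<le> 1 * B" for x
        unfolding abs_mult using B[of "cos x"] by (intro mult_mono) auto
    qed
    have "norm (\<integral>x. (sin x * c (cos x)) *\<^sub>R h x \<partial>leb_pi) \<le> e * (\<integral>x. norm (h x) \<partial>leb_pi)" if e: "e > 0" for e
    proof -
      obtain p where p: "real_polynomial_function p" "\<And>y. y \<in> {-1..1} \<Longrightarrow> \<bar>c y - p y\<bar> < e"
        using Stone_Weierstrass_real_polynomial_function[of "{-1..1::real}" c e] c e continuous_on_subset
        by (metis compact_Icc subset_UNIV)
      then obtain a n where pe: "p = (\<lambda>x. \<Sum>i\<le>n. a i * x ^ i)" by (auto simp: real_polynomial_function_iff_sum)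
      have i: "integrable leb_pi (\<lambda>x. (sin x * cos x ^ i) *\<^sub>R h x)" "(\<integral>x. (sin x * cos x ^ i) *\<^sub>R h x \<partial>leb_pi) = 0" for i
        using ci[of 1 i] 1[of 1 i] by simp_all
      have eq: "(\<lambda>x. (sin x * p (cos x)) *\<^sub>R h x) = (\<lambda>x. \<Sum>i\<le>n. a i *\<^sub>R ((sin x * cos x ^ i) *\<^sub>R h x))"
        by (simp add: pe sum_distrib_left scaleR_sum_left mult_ac)
      have ip: "integrable leb_pi (\<lambda>x. (sin x * p (cos x)) *\<^sub>R h x)" "(\<integral>x. (sin x * p (cos x)) *\<^sub>R h x \<partial>leb_pi) = 0"
        unfolding eq by (simp_all del: scaleR_scaleR add: i)
      have "(\<integral>x. (sin x * c (cos x)) *\<^sub>R h x \<partial>leb_pi) = (\<integral>x. (sin x * c (cos x)) *\<^sub>R h x - (sin x * p (cos x)) *\<^sub>R h x \<partial>leb_pi)"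
        using ic ip by simp
      also have "norm \<dots> \<le> (\<integral>x. norm ((sin x * c (cos x)) *\<^sub>R h x - (sin x * p (cos x)) *\<^sub>R h x) \<partial>leb_pi)"
        by (rule integral_norm_bound)
      also have "\<dots> \<le> (\<integral>x. e * norm (h x) \<partial>leb_pi)"
      proof (intro integral_mono integrable_norm Bochner_Integration.integrable_diff ic ip(1) integrable_mult_right h)
        fix x
        have "norm ((sin x * c (cos x)) *\<^sub>R h x - (sin x * p (cos x)) *\<^sub>R h x) = \<bar>sin x\<bar> * \<bar>c (cos x) - p (cos x)\<bar> * norm (h x)"
          by (simp add: scaleR_diff_left[symmetric] right_diff_distrib[symmetric] abs_mult)
        also have "\<dots> \<le> 1 * e * norm (h x)"
          using p(2)[of "cos x"] by (intro mult_mono) auto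
        finally show "norm ((sin x * c (cos x)) *\<^sub>R h x - (sin x * p (cos x)) *\<^sub>R h x) \<le> e * norm (h x)" by simp
      qed
      finally show ?thesis by simp
    qed
    moreover define I where "I = (\<integral>x. norm (h x) \<partial>leb_pi)"
    ultimately have "norm (\<integral>x. (sin x * c (cos x)) *\<^sub>R h x \<partial>leb_pi) \<le> e" if "e > 0" for e
    proof -
      have I: "I \<ge> 0" by (simp add: I_def)
      have "e / (I + 1) * I \<le> e" using I that by (simp add: field_simps)
      then show ?thesis
        using \<open>\<And>e. e > 0 \<Longrightarrow> norm (\<integral>x. (sin x * c (cos x)) *\<^sub>R h x \<partial>leb_pi) \<le> e * (\<integral>x. norm (h x) \<partial>leb_pi)\<close>[of "e / (I + 1)"] I that
        unfolding I_def[symmetric] by (simp add: divide_pos_pos)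
    qed
    then have "norm (\<integral>x. (sin x * c (cos x)) *\<^sub>R h x \<partial>leb_pi) \<le> 0" by (rule field_le_epsilon, unfold add_0)
    then show ?thesis by simp
  qed
  have 3: "AE x in leb_pi. \<phi> (h x) = 0" if \<phi>: "bounded_linear (\<phi> :: complex \<Rightarrow> real)" for \<phi>
  proof -
    define \<sigma> where "\<sigma> = (\<lambda>x. \<phi> (h x) / (1 + \<bar>\<phi> (h x)\<bar>))"
    have i\<phi>: "integrable leb_pi (\<lambda>x. \<phi> (h x))" by (rule integrable_bounded_linear[OF \<phi> h])
    have m\<phi>: "(\<lambda>x. \<phi> (h x)) \<in> borel_measurable leb_pi" using i\<phi> by simp
    then have "\<sigma> \<in> borel_measurable leb_pi" unfolding \<sigma>_def by measurable
    then have "\<sigma> measurable_on {0<..<pi}" by (simp add: measurable_on_iff_borel_measurable)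
    then obtain N g where N: "negligible N" and g: "\<And>n. continuous_on UNIV (g n)"
      and lim: "\<And>x. x \<notin> N \<Longrightarrow> (\<lambda>n. g n x) \<longlonglongrightarrow> (if x \<in> {0<..<pi} then \<sigma> x else 0)"
      unfolding measurable_on_def by blast
    have \<sigma>1: "\<sigma> x \<in> {-1..1}" for x
    proof -
      have "\<bar>\<sigma> x\<bar> = \<bar>\<phi> (h x)\<bar> / (1 + \<bar>\<phi> (h x)\<bar>)" by (simp add: \<sigma>_def abs_divide)
      also have "\<dots> \<le> 1" by (subst divide_le_eq_1_pos) auto
      finally show ?thesis by auto
    qed
    define c where "c = (\<lambda>n x. max (-1) (min 1 (g n x)))"
    have c1: "\<bar>c n x\<bar> \<le> 1" for n x by (auto simp: c_def)
    have cc: "continuous_on UNIV (c n)" for n unfolding c_def by (intro continuous_intros g)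
    have z: "(\<integral>x. (sin x * c n x) *\<^sub>R \<phi> (h x) \<partial>leb_pi) = 0" for n
    proof -
      define d where "d = (\<lambda>y. c n (arccos (max (-1) (min 1 y))))"
      have "continuous_on UNIV d" unfolding d_def
        by (rule continuous_on_compose2[OF cc], rule continuous_on_compose2[OF continuous_on_arccos'])
          (auto intro!: continuous_intros)
      then have "(\<integral>x. (sin x * d (cos x)) *\<^sub>R h x \<partial>leb_pi) = 0" by (rule 2)
      moreover have "(\<integral>x. (sin x * d (cos x)) *\<^sub>R h x \<partial>leb_pi) = (\<integral>x. (sin x * c n x) *\<^sub>R h x \<partial>leb_pi)"
        by (rule Bochner_Integration.integral_cong) (auto simp: d_def arccos_cos)
      moreover have "(\<integral>x. \<phi> ((sin x * c n x) *\<^sub>R h x) \<partial>leb_pi) = \<phi> (\<integral>x. (sin x * c n x) *\<^sub>R h x \<partial>leb_pi)"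
        by (rule integral_bounded_linear[OF \<phi>])
          (intro integrable_bounded_mult[OF h, where B = "1 * 1"] continuous_lebesgue_measurable continuous_intros cc,
            unfold abs_mult, intro mult_mono, auto simp: c1)
      ultimately show ?thesis
        by (simp add: linear_simps[OF \<phi>])
    qed
    have "(\<lambda>n. \<integral>x. (sin x * c n x) *\<^sub>R \<phi> (h x) \<partial>leb_pi) \<longlonglongrightarrow> (\<integral>x. (sin x * \<sigma> x) *\<^sub>R \<phi> (h x) \<partial>leb_pi)"
    proof (rule integral_dominated_convergence[where w = "\<lambda>x. \<bar>\<phi> (h x)\<bar>"])
      have sm: "(\<lambda>x. sin x :: real) \<in> borel_measurable leb_pi" "c n \<in> borel_measurable leb_pi" for n
        by (intro continuous_lebesgue_measurable continuous_intros cc)+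
      show "(\<lambda>x. (sin x * \<sigma> x) *\<^sub>R \<phi> (h x)) \<in> borel_measurable leb_pi" "(\<lambda>x. (sin x * c n x) *\<^sub>R \<phi> (h x)) \<in> borel_measurable leb_pi" for n
        using \<open>\<sigma> \<in> borel_measurable leb_pi\<close> m\<phi> sm by measurable
      show "integrable leb_pi (\<lambda>x. \<bar>\<phi> (h x)\<bar>)" using i\<phi> by simp
      show "AE x in leb_pi. norm ((sin x * c n x) *\<^sub>R \<phi> (h x)) \<le> \<bar>\<phi> (h x)\<bar>" for n
        by (intro AE_I2) (auto simp: abs_mult intro!: mult_left_le_one_le mult_le_one c1)
      have "AE x in lebesgue. x \<notin> N" using N by (simp add: AE_not_in negligible_iff_null_sets)
      then have "AE x in leb_pi. x \<notin> N" by (subst AE_restrict_space_iff) auto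
      then show "AE x in leb_pi. (\<lambda>n. (sin x * c n x) *\<^sub>R \<phi> (h x)) \<longlonglongrightarrow> (sin x * \<sigma> x) *\<^sub>R \<phi> (h x)"
      proof (rule AE_mp, intro AE_I2 impI)
        fix x assume x: "x \<in> space leb_pi" "x \<notin> N"
        then have "(\<lambda>n. g n x) \<longlonglongrightarrow> \<sigma> x" using lim[of x] by simp
        then have "(\<lambda>n. c n x) \<longlonglongrightarrow> max (-1) (min 1 (\<sigma> x))" unfolding c_def by (intro tendsto_intros)
        then have "(\<lambda>n. c n x) \<longlonglongrightarrow> \<sigma> x" using \<sigma>1[of x] by simp
        then show "(\<lambda>n. (sin x * c n x) *\<^sub>R \<phi> (h x)) \<longlonglongrightarrow> (sin x * \<sigma> x) *\<^sub>R \<phi> (h x)" by (intro tendsto_intros)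
      qed
    qed
    then have e: "(\<integral>x. (sin x * \<sigma> x) *\<^sub>R \<phi> (h x) \<partial>leb_pi) = 0" unfolding z by (simp add: LIMSEQ_const_iff)
    have nn: "(sin x * \<sigma> x) *\<^sub>R \<phi> (h x) = sin x * ((\<phi> (h x))\<^sup>2 / (1 + \<bar>\<phi> (h x)\<bar>))" for x
      by (simp add: \<sigma>_def power2_eq_square)
    have "AE x in leb_pi. (sin x * \<sigma> x) *\<^sub>R \<phi> (h x) = 0"
    proof (subst integral_nonneg_eq_0_iff_AE[symmetric])
      have sm: "(\<lambda>x. sin x :: real) \<in> borel_measurable leb_pi"
        by (intro continuous_lebesgue_measurable continuous_intros)
      show "integrable leb_pi (\<lambda>x. (sin x * \<sigma> x) *\<^sub>R \<phi> (h x))"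
      proof (rule Bochner_Integration.integrable_bound[OF i\<phi>])
        show "(\<lambda>x. (sin x * \<sigma> x) *\<^sub>R \<phi> (h x)) \<in> borel_measurable leb_pi"
          using \<open>\<sigma> \<in> borel_measurable leb_pi\<close> m\<phi> sm by measurable
        show "AE x in leb_pi. norm ((sin x * \<sigma> x) *\<^sub>R \<phi> (h x)) \<le> norm (\<phi> (h x))"
          using \<sigma>1 by (intro AE_I2) (auto simp: abs_mult abs_le_iff intro!: mult_left_le_one_le mult_le_one)
      qed
      show "AE x in leb_pi. 0 \<le> (sin x * \<sigma> x) *\<^sub>R \<phi> (h x)"
        unfolding nn by (intro AE_I2) (auto intro!: mult_nonneg_nonneg divide_nonneg_nonneg sin_ge_zero)
    qed (rule e)
    then show ?thesis
    proof (rule AE_mp, intro AE_I2 impI)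
      fix x assume x: "x \<in> space leb_pi" "(sin x * \<sigma> x) *\<^sub>R \<phi> (h x) = 0"
      then have "sin x > 0" by (intro sin_gt_zero) auto
      with x(2) show "\<phi> (h x) = 0" unfolding nn using abs_ge_zero[of "\<phi> (h x)"] by (auto simp del: abs_ge_zero)
    qed
  qed
  from 3[OF bounded_linear_Re] 3[OF bounded_linear_Im] show ?thesis
    by eventually_elim (simp add: complex_eq_iff)
qed

lemma H_fun_summable:
  assumes "H_fun 2 f" shows "summable (\<lambda>k. norm (sine_coeff f (Suc k)))"
proof (rule summable_comparison_test')
  let ?a = "\<lambda>k. bracket (Suc k) powr (2 * 2) * (norm (sine_coeff f (Suc k)))\<^sup>2"
  have "summable (\<lambda>n. inverse ((real n)\<^sup>2))" by (rule inverse_power_summable) simp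
  then have "summable (\<lambda>n. inverse ((real (Suc n))\<^sup>2))" by (subst summable_Suc_iff)
  then show "summable (\<lambda>k. ?a k + inverse ((real (Suc k))\<^sup>2))"
    using assms unfolding H_fun_def by (intro summable_add) auto
  fix k
  define N where "N = real (Suc k)"
  define c where "c = norm (sine_coeff f (Suc k))"
  have N: "N \<ge> 1" by (simp add: N_def)
  have c: "c \<ge> 0" by (simp add: c_def)
  have "bracket (Suc k) powr (2 * 2) = (bracket (Suc k))\<^sup>2 ^ 2"
  proof -
    have "bracket (Suc k) > 0" by (simp add: bracket_def add_pos_nonneg)
    then show ?thesis using powr_realpow[of "bracket (Suc k)" 4] by (simp add: power_mult[symmetric])
  qed
  also have "(bracket (Suc k))\<^sup>2 = 1 + N\<^sup>2" by (simp add: bracket_def N_def add_nonneg_nonneg)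
  finally have b: "bracket (Suc k) powr (2 * 2) = (1 + N\<^sup>2)\<^sup>2" .
  have "N ^ 2 \<le> (1 + N\<^sup>2)\<^sup>2" using N by (intro power_mono) (auto simp: power2_eq_square intro: order_trans[of _ "N * N"])
  then have "N ^ 2 * c\<^sup>2 \<le> (1 + N\<^sup>2)\<^sup>2 * c\<^sup>2" by (rule mult_right_mono) simp
  moreover have "c \<le> N ^ 2 * c\<^sup>2 + inverse (N\<^sup>2)"
  proof -
    have "N * inverse N = 1" using N by simp
    then have "(N * c - inverse N)\<^sup>2 = N\<^sup>2 * c\<^sup>2 - 2 * c + inverse (N\<^sup>2)"
      by (simp add: power2_eq_square algebra_simps)
    with zero_le_power2[of "N * c - inverse N"] c show ?thesis by linarith
  qed
  ultimately show "norm (norm (sine_coeff f (Suc k))) \<le> ?a k + inverse ((real (Suc k))\<^sup>2)"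
    unfolding b c_def[symmetric] N_def[symmetric] using c by simp
qed

lemma heat_sol_continuous:
  assumes "H_fun 2 f" shows "continuous_on (UNIV \<times> {0..}) (\<lambda>(x, t). heat_sol f x t)"
proof -
  let ?g = "\<lambda>k (p :: real \<times> real). (exp (- (real (Suc k))\<^sup>2 * snd p) * sin (real (Suc k) * fst p)) *\<^sub>R sine_coeff f (Suc k)"
  have "norm (?g k p) \<le> norm (sine_coeff f (Suc k))" if "p \<in> UNIV \<times> {0..}" for k p
  proof -
    have "snd p \<ge> 0" using that by auto
    then have "\<bar>exp (- (real (Suc k))\<^sup>2 * snd p) * sin (real (Suc k) * fst p)\<bar> \<le> 1"
      unfolding abs_mult by (intro mult_le_one) auto
    then show ?thesis by (simp del: of_nat_Suc add: mult_left_le_one_le)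
  qed
  then have "uniform_limit (UNIV \<times> {0..}) (\<lambda>n p. \<Sum>k<n. ?g k p) (\<lambda>p. \<Sum>k. ?g k p) sequentially"
    by (rule Weierstrass_m_test[OF _ H_fun_summable[OF assms]])
  then have "continuous_on (UNIV \<times> {0..}) (\<lambda>p. \<Sum>k. ?g k p)"
    by (rule uniform_limit_theorem[rotated]) (auto intro!: always_eventually continuous_intros)
  then show ?thesis by (simp add: heat_sol_def case_prod_unfold del: of_nat_Suc)
qed

lemma sin_orthogonal:
  assumes "j \<ge> 1" "k \<ge> 1"
  shows "(\<integral>x. sin (real j * x) * sin (real k * x) \<partial>leb_pi) = (if j = k then pi / 2 else 0)"
proof -
  have "finite_measure leb_pi" by (rule finite_measureI) (simp add: emeasure_restrict_space)
  then have i: "integrable leb_pi (\<lambda>x. sin (real j * x) * sin (real k * x))"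
    by (rule finite_measure.integrable_const_bound[where B = 1])
      (auto intro!: borel_measurable_times sin_lebesgue_measurable mult_le_one simp: abs_mult)
  let ?c = "\<lambda>a x. if a = 0 then x else sin (a * x) / a"
  have d: "((\<lambda>x. ?c a x) has_vector_derivative cos (a * x)) (at x within {0..pi})" for a x :: real
    unfolding has_real_derivative_iff_has_vector_derivative[symmetric]
    by (cases "a = 0") (auto intro!: derivative_eq_intros)
  have s: "sin (real j * x) * sin (real k * x) = (cos ((real j - real k) * x) - cos ((real j + real k) * x)) / 2" for x
    by (simp add: sin_times_sin algebra_simps)
  have "((\<lambda>x. (cos ((real j - real k) * x) - cos ((real j + real k) * x)) / 2) has_integral
     ((?c (real j - real k) pi - ?c (real j - real k) 0) - (?c (real j + real k) pi - ?c (real j + real k) 0)) / 2) {0..pi}"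
    by (intro has_integral_divide has_integral_diff fundamental_theorem_of_calculus d) auto
  moreover have "sin ((real j - real k) * pi) = 0" "sin ((real j + real k) * pi) = 0"
    by (simp_all add: left_diff_distrib distrib_right sin_diff sin_add)
  ultimately have "((\<lambda>x. sin (real j * x) * sin (real k * x)) has_integral (if j = k then pi / 2 else 0)) {0..pi}"
    unfolding s using assms by (auto split: if_splits)
  then have "integral {0<..<pi} (\<lambda>x. sin (real j * x) * sin (real k * x)) = (if j = k then pi / 2 else 0)"
    by (simp add: has_integral_Icc_iff_Ioo integral_unique)
  then show ?thesis using lebesgue_integral_eq_integral[OF i] by simp
qed

lemma heat_sol_initial:
  assumes "H_fun 2 f" shows "AE x in leb_pi. heat_sol f x 0 = f x"
proof -
  define a where "a = (\<lambda>k. sine_coeff f (Suc k))"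
  have sa: "summable (\<lambda>k. norm (a k))" unfolding a_def by (rule H_fun_summable[OF assms])
  have f: "integrable leb_pi f" using assms by (simp add: H_fun_def L2_fun_integrable)
  interpret finite_measure leb_pi by (rule finite_measureI) (simp add: emeasure_restrict_space)
  define B where "B = measure leb_pi (space leb_pi)"
  have B: "B \<ge> 0" by (simp add: B_def)
  have g: "integrable leb_pi (\<lambda>x. \<Sum>k. b x k *\<^sub>R a k)" "(\<lambda>k. \<integral>x. b x k *\<^sub>R a k \<partial>leb_pi) sums (\<integral>x. (\<Sum>k. b x k *\<^sub>R a k) \<partial>leb_pi)"
    if m: "\<And>k. (\<lambda>x. b x k) \<in> borel_measurable leb_pi" and b: "\<And>x k. \<bar>b x k\<bar> \<le> 1" for b :: "real \<Rightarrow> nat \<Rightarrow> real"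
  proof -
    have n: "norm (b x k *\<^sub>R a k) \<le> norm (a k)" for x k using b[of x k] by (simp add: mult_left_le_one_le)
    have 1: "integrable leb_pi (\<lambda>x. b x k *\<^sub>R a k)" for k
      using m n by (intro integrable_const_bound[where B = "norm (a k)"]) auto
    have 2: "AE x in leb_pi. summable (\<lambda>k. norm (b x k *\<^sub>R a k))"
      using n by (intro AE_I2 summable_comparison_test'[OF sa]) auto
    have 3: "summable (\<lambda>k. \<integral>x. norm (b x k *\<^sub>R a k) \<partial>leb_pi)"
    proof (rule summable_comparison_test'[OF summable_mult[OF sa, of B]])
      fix k
      have "(\<integral>x. norm (b x k *\<^sub>R a k) \<partial>leb_pi) \<le> (\<integral>x. norm (a k) \<partial>leb_pi)"
        using 1 n by (intro integral_mono integrable_norm) auto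
      then show "norm (\<integral>x. norm (b x k *\<^sub>R a k) \<partial>leb_pi) \<le> B * norm (a k)" by (simp add: B_def)
    qed
    show "integrable leb_pi (\<lambda>x. \<Sum>k. b x k *\<^sub>R a k)" by (rule integrable_suminf[OF 1 2 3])
    show "(\<lambda>k. \<integral>x. b x k *\<^sub>R a k \<partial>leb_pi) sums (\<integral>x. (\<Sum>k. b x k *\<^sub>R a k) \<partial>leb_pi)" by (rule sums_integral[OF 1 2 3])
  qed
  have h: "heat_sol f x 0 = (\<Sum>k. sin (real (Suc k) * x) *\<^sub>R a k)" for x by (simp add: heat_sol_def a_def)
  have ih: "integrable leb_pi (\<lambda>x. heat_sol f x 0)"
    unfolding h by (rule g(1)) (auto intro: sin_lebesgue_measurable simp del: of_nat_Suc)
  have "AE x in leb_pi. heat_sol f x 0 - f x = 0"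
  proof (rule sine_complete)
    show "integrable leb_pi (\<lambda>x. heat_sol f x 0 - f x)" using ih f by simp
    fix j :: nat assume j: "j \<ge> 1"
    have "sin (real j * x) *\<^sub>R heat_sol f x 0 = (\<Sum>k. (sin (real j * x) * sin (real (Suc k) * x)) *\<^sub>R a k)" for x
    proof -
      have "summable (\<lambda>k. sin (real (Suc k) * x) *\<^sub>R a k)"
        by (rule summable_comparison_test'[OF sa]) (simp add: mult_left_le_one_le del: of_nat_Suc)
      then show ?thesis unfolding h by (simp add: suminf_scaleR_right)
    qed
    moreover have "(\<lambda>k. \<integral>x. (sin (real j * x) * sin (real (Suc k) * x)) *\<^sub>R a k \<partial>leb_pi) sums
      (\<integral>x. (\<Sum>k. (sin (real j * x) * sin (real (Suc k) * x)) *\<^sub>R a k) \<partial>leb_pi)"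
      by (rule g(2)) (auto intro!: borel_measurable_times sin_lebesgue_measurable mult_le_one simp: abs_mult simp del: of_nat_Suc)
    moreover have "(\<integral>x. (sin (real j * x) * sin (real (Suc k) * x)) *\<^sub>R a k \<partial>leb_pi) = (if k = j - 1 then (pi / 2) *\<^sub>R a k else 0)" for k
    proof -
      have "integrable leb_pi (\<lambda>x. sin (real j * x) * sin (real (Suc k) * x))"
        by (rule integrable_const_bound[where B = 1])
          (auto intro!: borel_measurable_times sin_lebesgue_measurable mult_le_one simp: abs_mult simp del: of_nat_Suc)
      then have "(\<integral>x. (sin (real j * x) * sin (real (Suc k) * x)) *\<^sub>R a k \<partial>leb_pi) = (if j = Suc k then pi / 2 else 0) *\<^sub>R a k"
        using sin_orthogonal[OF j, of "Suc k"] by (simp del: of_nat_Suc)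
      then show ?thesis using j by auto
    qed
    ultimately have "(\<lambda>k. if k = j - 1 then (pi / 2) *\<^sub>R a k else 0) sums (\<integral>x. sin (real j * x) *\<^sub>R heat_sol f x 0 \<partial>leb_pi)"
      by simp
    then have "(\<integral>x. sin (real j * x) *\<^sub>R heat_sol f x 0 \<partial>leb_pi) = (pi / 2) *\<^sub>R a (j - 1)"
      using sums_unique2[OF _ sums_single[of "j - 1" "\<lambda>k. (pi / 2) *\<^sub>R a k"]] by simp
    also have "\<dots> = (\<integral>x. sin (real j * x) *\<^sub>R f x \<partial>leb_pi)"
      using j by (simp add: a_def sine_coeff_def)
    finally show "(\<integral>x. sin (real j * x) *\<^sub>R (heat_sol f x 0 - f x) \<partial>leb_pi) = 0"
      using integrable_sin_mult[OF ih, of "real j"] integrable_sin_mult[OF f, of "real j"]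
      by (simp add: scaleR_diff_right)
  qed
  then show ?thesis by simp
qed

end

(* At x0 the solution is G(exp(-t)), where G(w) = sum_k c_k w^(k^2) with c_k = sin(k x0) * (k-th sine
   coefficient) is bounded on the unit disc. A set of positive measure contains n points with gaps of
   order 1/n for every n. Lagrange interpolation of G at the corresponding nodes, with Blaschke factors
   in place of linear ones, has an error of order q^n for some q < 1, while the interpolant is at most
   K^n times the size \<epsilon> of the data. Cauchy's inequality turns this into a bound on c_k, and the choice of
   n proportional to N^2 controls all frequencies up to N at the cost \<epsilon> * \<Lambda>^(N^2). Frequencies
   above N contribute at most m / N^2 because of the H^2 bound, and N^2 of order |ln \<epsilon>| balances
   both parts. *)

theory Submission
  imports Defs "HOL-Complex_Analysis.Conformal_Mappings"
begin

subsection \<open>Well separated nodes\<close>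

text \<open>Greedy selection: take a point close to the infimum, discard everything up to distance
  \<open>d\<close> beyond it, and repeat in what is left. Each round costs only slightly more than
  \<open>d\<close> of measure, and the strict inequality pays for the excess.\<close>

lemma spaced_points:
  fixes A :: "real set"
  assumes "A \<in> lmeasurable" "bdd_below A" "0 \<le> d" "real n * d < measure lebesgue A"
  shows "\<exists>t::nat \<Rightarrow> real. (\<forall>i\<le>n. t i \<in> A) \<and> (\<forall>i<n. t i + d \<le> t (Suc i))"
  using assms
proof (induction n arbitrary: A)
  case 0
  then have "A \<noteq> {}" by auto
  then show ?case by auto
next
  case (Suc n)
  \<comment> \<open>The slack in the measure hypothesis. A first point within \<open>g\<close> of
    the infimum leaves a set of measure above \<open>real n * d\<close>.\<close>
  define g where "g = measure lebesgue A - real (Suc n) * d"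
  have g: "g > 0" using Suc.prems by (simp add: g_def)
  have "0 < measure lebesgue A"
    using Suc.prems mult_nonneg_nonneg[of "real (Suc n)" d] by linarith
  then have "A \<noteq> {}" by auto
  then obtain t0 where t0: "t0 \<in> A" "t0 < Inf A + g"
    using cInf_lessD[of A "Inf A + g"] g by auto
  define A' where "A' = A - {Inf A..t0 + d}"
  have m: "{Inf A..t0 + d} \<in> lmeasurable" by simp
  have A': "A' \<in> lmeasurable" unfolding A'_def using Suc.prems m by (intro fmeasurable.Diff) auto
  have inf: "Inf A \<le> t0" using t0 Suc.prems by (intro cInf_lower)
  have "measure lebesgue A \<le> measure lebesgue (A' \<union> {Inf A..t0 + d})"
    using A' m by (intro measure_mono_fmeasurable fmeasurable.Un fmeasurableD Suc.prems) (auto simp: A'_def)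
  also have "\<dots> \<le> measure lebesgue A' + measure lebesgue {Inf A..t0 + d}"
    using A' m by (intro measure_Un_le fmeasurableD)
  also have "measure lebesgue {Inf A..t0 + d} = t0 + d - Inf A" using inf Suc.prems by simp
  finally have "real n * d < measure lebesgue A'" using t0 by (simp add: g_def algebra_simps)
  moreover have "bdd_below A'" using Suc.prems by (auto simp: A'_def intro: bdd_below_mono)
  ultimately obtain t where t: "\<forall>i\<le>n. t i \<in> A'" "\<forall>i<n. t i + d \<le> t (Suc i)"
    using Suc.IH[OF A'] Suc.prems by blast
  have "t0 + d \<le> t 0"
  proof -
    have "t 0 \<in> A'" using t by simp
    moreover from this have "Inf A \<le> t 0" using Suc.prems by (intro cInf_lower) (auto simp: A'_def)
    ultimately show ?thesis by (auto simp: A'_def)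
  qed
  then show ?case using t t0
    by (intro exI[of _ "case_nat t0 t"]) (auto simp: A'_def split: nat.split)
qed

text \<open>Consecutive gaps add up by telescoping; the case split only orders the two
  indices.\<close>

lemma spaced_points_dist:
  fixes t :: "nat \<Rightarrow> real"
  assumes "\<forall>i<n. t i + d \<le> t (Suc i)" "i \<le> n" "j \<le> n"
  shows "\<bar>real i - real j\<bar> * d \<le> \<bar>t i - t j\<bar>"
proof -
  have *: "real k * d \<le> t (i + k) - t i" if "i + k \<le> n" for i k
    using that
  proof (induction k)
    case (Suc k)
    have "t (i + k) + d \<le> t (Suc (i + k))" using assms Suc.prems by auto
    with Suc show ?case by (simp add: algebra_simps)
  qed simp
  show ?thesis
  proof (cases "i \<le> j")
    case True
    then show ?thesis using *[of i "j - i"] assms by (simp add: of_nat_diff abs_if)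
  next
    case False
    then show ?thesis using *[of j "i - j"] assms by (simp add: of_nat_diff abs_if)
  qed
qed

section \<open>Lower bounds for products of node distances\<close>

text \<open>A single term of the exponential series at \<open>n\<close> is at most the whole
  sum.\<close>

lemma fact_ge_power: "(real n / exp 1) ^ n \<le> fact n"
proof -
  have "real n ^ n / fact n \<le> exp (real n)"
    using sum_le_suminf[of "\<lambda>k. real n ^ k /\<^sub>R fact k" "{n}"]
      summable_exp_generic[of "real n"]
    by (simp add: exp_def divide_inverse mult.commute)
  then show ?thesis by (simp add: field_simps power_divide flip: exp_of_nat_mult)
qed

text \<open>Indices below \<open>j\<close> contribute the distances from 1 to \<open>j\<close>,
  those above contribute 1 to \<open>n - 1 - j\<close>. Up to sign these are the Lagrange
  denominators for integer nodes.\<close>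

lemma prod_index_distance:
  assumes "j < n"
  shows "(\<Prod>i\<in>{..<n} - {j}. \<bar>real i - real j\<bar>) = fact j * fact (n - 1 - j)"
proof -
  have 1: "(\<Prod>i<j. \<bar>real i - real j\<bar>) = fact j"
  proof -
    have "(\<Prod>i<j. \<bar>real i - real j\<bar>) = (\<Prod>i<j. real (Suc i))"
      by (rule prod.reindex_bij_witness[where i = "\<lambda>i. j - Suc i" and j = "\<lambda>i. j - Suc i"])
        (auto simp: of_nat_diff)
    also have "\<dots> = fact j" by (simp add: fact_prod_Suc lessThan_atLeast0)
    finally show ?thesis .
  qed
  have 2: "(\<Prod>i=Suc j..<n. \<bar>real i - real j\<bar>) = fact (n - 1 - j)"
  proof -
    have "(\<Prod>i=Suc j..<n. \<bar>real i - real j\<bar>) = (\<Prod>i=0..<n - 1 - j. real (Suc i))"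
      by (rule prod.reindex_bij_witness[where i = "\<lambda>i. i + Suc j" and j = "\<lambda>i. i - Suc j"])
        (auto simp: of_nat_diff)
    then show ?thesis by (simp add: fact_prod_Suc)
  qed
  have "{..<n} - {j} = {..<j} \<union> {Suc j..<n}" using assms by auto
  moreover have "(\<Prod>i\<in>{..<j} \<union> {Suc j..<n}. \<bar>real i - real j\<bar>) =
      (\<Prod>i<j. \<bar>real i - real j\<bar>) * (\<Prod>i=Suc j..<n. \<bar>real i - real j\<bar>)"
    by (rule prod.union_disjoint) auto
  ultimately show ?thesis using 1 2 by simp
qed

text \<open>The factorials produced by equal spacing \<open>\<eta> / n\<close> compensate the factor \<open>n ^ n\<close>, so that the
  product decays only geometrically in \<open>n\<close>.\<close>

lemma prod_node_distance_ge:
  fixes s :: "nat \<Rightarrow> real"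
  assumes j: "j < n" and \<eta>: "0 < \<eta>" "\<eta> \<le> 1"
    and s: "\<And>i. i < n \<Longrightarrow> \<bar>real i - real j\<bar> * (\<eta> / real n) \<le> \<bar>s i - s j\<bar>"
  shows "(\<eta> / (2 * exp 1)) ^ n \<le> (\<Prod>i\<in>{..<n} - {j}. \<bar>s i - s j\<bar>)"
proof -
  define m where "m = n - 1"
  have n: "n = Suc m" "j \<le> m" using j by (auto simp: m_def)
  have "(real n / exp 1) ^ n \<le> real n * fact m"
    using fact_ge_power[of n] by (simp add: n)
  \<comment> \<open>The product of the two factorials falls short of \<open>fact m\<close> by a
    binomial coefficient, hence by a factor of at most \<open>2 ^ m\<close>, whatever
    \<open>j\<close> is.\<close>
  also have "fact m = real (fact j * fact (m - j) * (m choose j))"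
    using binomial_fact_lemma[OF n(2)] by (metis of_nat_fact)
  also have "\<dots> \<le> fact j * fact (m - j) * 2 ^ m"
    using binomial_le_pow2[of m j] by (simp add: mult_left_mono flip: of_nat_power)
  finally have "(real n / exp 1) ^ n \<le> real n * (fact j * fact (m - j) * 2 ^ m)"
    by (simp add: mult_left_mono)
  then have f: "(real n) ^ m / exp 1 ^ n \<le> fact j * fact (m - j) * 2 ^ m"
    using n by (simp add: power_divide divide_simps mult_ac del: of_nat_Suc)
  have "(\<eta> / (2 * exp 1)) ^ n = \<eta> ^ n / (2 ^ n * exp 1 ^ n)" by (simp add: power_divide power_mult_distrib)
  also have "\<dots> \<le> \<eta> ^ m / (2 ^ m * exp 1 ^ n)"
    using \<eta> n by (intro frac_le mult_right_mono power_decreasing power_increasing) auto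
  also have "\<dots> = (\<eta> / real n) ^ m * ((real n ^ m / exp 1 ^ n) / 2 ^ m)"
    using n by (simp add: power_divide del: of_nat_Suc)
  also have "\<dots> \<le> (\<eta> / real n) ^ m * ((fact j * fact (m - j) * 2 ^ m) / 2 ^ m)"
    using f \<eta> by (intro mult_left_mono divide_right_mono) auto
  also have "\<dots> = (\<Prod>i\<in>{..<n} - {j}. \<bar>real i - real j\<bar> * (\<eta> / real n))"
    unfolding prod.distrib using j prod_index_distance[OF j] by (simp add: m_def)
  also have "\<dots> \<le> (\<Prod>i\<in>{..<n} - {j}. \<bar>s i - s j\<bar>)"
    using s \<eta> by (intro prod_mono) auto
  finally show ?thesis .
qed

subsection \<open>Blaschke factors\<close>

text \<open>For \<open>\<bar>t\<bar> < 1\<close> this is the automorphism of the unit disc with its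
  zero at \<open>t\<close>. As \<open>t\<close> is real, the denominator carries no
  conjugate.\<close>

definition blaschke :: "real \<Rightarrow> complex \<Rightarrow> complex" where
  "blaschke t w = (w - of_real t) / (1 - of_real t * w)"

text \<open>Divided by the first square, this computes one minus the squared modulus of a Blaschke
  factor. It yields both modulus one on the unit circle and contraction inside.\<close>

lemma blaschke_norm_diff:
  fixes w :: complex
  shows "(norm (1 - of_real t * w))\<^sup>2 - (norm (w - of_real t))\<^sup>2 = (1 - t\<^sup>2) * (1 - (norm w)\<^sup>2)"
  unfolding cmod_power2 by (simp add: power2_eq_square algebra_simps)

lemma blaschke_denom:
  fixes w :: complex
  assumes "0 \<le> t" "t < 1" "norm w \<le> 1"
  shows "0 < norm (1 - of_real t * w)" "norm (1 - of_real t * w) \<le> 2" "1 - of_real t * w \<noteq> 0"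
proof -
  have tw: "norm (of_real t * w) \<le> t" using assms by (simp add: norm_mult mult_left_le)
  have "norm (1::complex) - norm (of_real t * w) \<le> norm (1 - of_real t * w)" by (rule norm_triangle_ineq2)
  then show *: "0 < norm (1 - of_real t * w)" using tw assms unfolding norm_one by linarith
  have "norm (1 - of_real t * w) \<le> norm (1::complex) + norm (of_real t * w)" by (rule norm_triangle_ineq4)
  then show "norm (1 - of_real t * w) \<le> 2" using tw assms unfolding norm_one by linarith
  show "1 - of_real t * w \<noteq> 0" using * zero_less_norm_iff by blast
qed

text \<open>The denominator has modulus at most 2, so by \<open>blaschke_norm_diff\<close> one minus
  the squared modulus is at least a quarter of the product there. The bound is uniform in
  \<open>t\<close> and \<open>w\<close>, and below 1 as soon as \<open>r < 1\<close>.\<close>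

lemma norm_blaschke_le:
  assumes "0 \<le> t" "t \<le> b" "b < 1" "norm w \<le> r" "r \<le> 1"
  shows "norm (blaschke t w) \<le> sqrt (1 - (1 - b\<^sup>2) * (1 - r\<^sup>2) / 4)"
proof (rule real_le_rsqrt)
  let ?d = "norm (1 - of_real t * w)"
  have d: "0 < ?d" "?d \<le> 2" using blaschke_denom[of t w] assms by auto
  have tb: "t\<^sup>2 \<le> b\<^sup>2" "(norm w)\<^sup>2 \<le> r\<^sup>2" "b\<^sup>2 \<le> 1" "r\<^sup>2 \<le> 1"
    using assms order_trans[OF norm_ge_zero assms(4)] by (auto intro!: power_mono power_le_one)
  have "(1 - b\<^sup>2) * (1 - r\<^sup>2) * (?d\<^sup>2 / 4) \<le> (1 - b\<^sup>2) * (1 - r\<^sup>2) * 1"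
    using d tb power_mono[OF d(2), of 2] by (intro mult_left_mono) auto
  also have "\<dots> \<le> (1 - t\<^sup>2) * (1 - (norm w)\<^sup>2)"
    unfolding mult_1_right using tb by (intro mult_mono) auto
  finally have "(norm (w - of_real t))\<^sup>2 \<le> ?d\<^sup>2 - (1 - b\<^sup>2) * (1 - r\<^sup>2) * (?d\<^sup>2 / 4)"
    unfolding blaschke_norm_diff[symmetric] by linarith
  also have "\<dots> = (1 - (1 - b\<^sup>2) * (1 - r\<^sup>2) / 4) * ?d\<^sup>2" by (simp add: left_diff_distrib)
  finally have "(norm (w - of_real t))\<^sup>2 \<le> (1 - (1 - b\<^sup>2) * (1 - r\<^sup>2) / 4) * ?d\<^sup>2" .
  then show "(norm (blaschke t w))\<^sup>2 \<le> 1 - (1 - b\<^sup>2) * (1 - r\<^sup>2) / 4"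
    using d by (simp add: blaschke_def norm_divide power_divide pos_divide_le_eq)
qed

lemma norm_blaschke_le_1:
  assumes "0 \<le> t" "t < 1" "norm w \<le> 1"
  shows "norm (blaschke t w) \<le> 1"
  using norm_blaschke_le[of t t w 1] assms by simp

text \<open>At real points the denominator \<open>1 - t * s\<close> lies in \<open>{0<..1}\<close>,
  so dividing by it only enlarges. Node distances thereby bound the interpolation denominators from
  below.\<close>

lemma norm_blaschke_real_ge:
  assumes "s \<in> {0..<1}" "t \<in> {0..<1}"
  shows "\<bar>s - t\<bar> \<le> norm (blaschke t (of_real s))"
proof -
  have e: "blaschke t (of_real s) = of_real ((s - t) / (1 - t * s))" by (simp add: blaschke_def)
  have "t * s < 1" using assms mult_strict_mono'[of t 1 s 1] by auto
  moreover have "0 \<le> t * s" using assms by auto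
  ultimately show ?thesis unfolding e norm_of_real abs_divide
    by (simp add: le_divide_eq mult_left_le)
qed

section \<open>Division by zeros and the Schwarz lemma\<close>

text \<open>The zeros are divided out one at a time. Distinctness makes the earlier factors nonzero
  at the next node, so the quotient itself vanishes there.\<close>

lemma holomorphic_factor_zeros:
  fixes z :: "nat \<Rightarrow> complex"
  assumes S: "open S" and F: "F holomorphic_on S"
    and z: "inj_on z {..<n}" "\<And>i. i < n \<Longrightarrow> z i \<in> S" "\<And>i. i < n \<Longrightarrow> F (z i) = 0"
  shows "\<exists>H. H holomorphic_on S \<and> (\<forall>w\<in>S. F w = (\<Prod>i<n. w - z i) * H w)"
  using z
proof (induction n)
  case 0
  then show ?case using F by auto
next
  case (Suc n)
  have "inj_on z {..<n}" using Suc.prems(1) by (rule inj_on_subset) auto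
  then obtain H where H: "H holomorphic_on S" "\<And>w. w \<in> S \<Longrightarrow> F w = (\<Prod>i<n. w - z i) * H w"
    using Suc by force
  have "z n \<noteq> z i" if "i < n" for i
    using inj_onD[OF Suc.prems(1), of n i] that by auto
  then have "(\<Prod>i<n. z n - z i) \<noteq> 0" by auto
  then have H0: "H (z n) = 0" using H(2)[of "z n"] Suc.prems by auto
  \<comment> \<open>The difference quotient, continued through its removable singularity by the
    derivative.\<close>
  define H' where "H' = (\<lambda>w. if w = z n then deriv H (z n) else (H w - H (z n)) / (w - z n))"
  have "H' holomorphic_on S" unfolding H'_def by (rule pole_lemma_open[OF H(1) S])
  moreover have "H w = (w - z n) * H' w" for w by (simp add: H'_def H0)
  ultimately show ?case using H(2) by (intro exI[of _ H']) (auto simp: mult_ac)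
qed

text \<open>The Schwarz lemma with several zeros. Division by the Blaschke product does not change
  the modulus on the unit circle, so the maximum principle bounds the quotient by \<open>M\<close>
  on the whole disc.\<close>

lemma blaschke_schwarz:
  fixes s :: "nat \<Rightarrow> real"
  assumes S: "open S" "cball 0 1 \<subseteq> S" and F: "F holomorphic_on S"
    and s: "inj_on s {..<n}" "\<And>i. i < n \<Longrightarrow> s i \<in> {0..<1}" "\<And>i. i < n \<Longrightarrow> F (of_real (s i)) = 0"
    and M: "\<And>w. norm w = 1 \<Longrightarrow> norm (F w) \<le> M" and w: "norm w \<le> 1"
  shows "norm (F w) \<le> (\<Prod>i<n. norm (blaschke (s i) w)) * M"
proof -
  have inj: "inj_on (\<lambda>i. complex_of_real (s i)) {..<n}" using s(1) by (auto simp: inj_on_def)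
  have "complex_of_real (s i) \<in> S" if "i < n" for i using s(2)[OF that] S(2) by auto
  then obtain H where H: "H holomorphic_on S" "\<And>w. w \<in> S \<Longrightarrow> F w = (\<Prod>i<n. w - of_real (s i)) * H w"
    using holomorphic_factor_zeros[OF S(1) F inj] s(3) by auto
  \<comment> \<open>The quotient of \<open>F\<close> by the Blaschke product, written without
    division so that it is holomorphic on all of \<open>S\<close>.\<close>
  define K where "K = (\<lambda>w. (\<Prod>i<n. 1 - of_real (s i) * w) * H w)"
  have K: "K holomorphic_on S" unfolding K_def by (intro holomorphic_intros H)
  have FK: "norm (F w) = (\<Prod>i<n. norm (blaschke (s i) w)) * norm (K w)" if "norm w \<le> 1" for w
  proof -
    have "w \<in> S" using that S(2) by auto
    moreover have "norm (w - of_real (s i)) = norm (blaschke (s i) w) * norm (1 - of_real (s i) * w)" if "i < n" for i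
      using blaschke_denom[of "s i" w] s(2)[OF that] \<open>norm w \<le> 1\<close> by (simp add: blaschke_def norm_divide)
    ultimately have "norm (F w) = (\<Prod>i<n. norm (blaschke (s i) w) * norm (1 - of_real (s i) * w)) * norm (H w)"
      by (simp add: H norm_mult prod_norm[symmetric] del: mult_cancel_right cong: prod.cong_simp)
    then show ?thesis unfolding prod.distrib K_def norm_mult prod_norm[symmetric] by simp
  qed
  have b1: "norm (blaschke (s i) w) = 1" if "norm w = 1" "i < n" for w i
  proof -
    have "norm (w - of_real (s i)) = norm (1 - of_real (s i) * w)"
      using blaschke_norm_diff[of "s i" w] that by (intro power2_eq_imp_eq[of "norm _"]) auto
    then show ?thesis using blaschke_denom[of "s i" w] s(2)[of i] that by (simp add: blaschke_def norm_divide)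
  qed
  have "norm (K w) \<le> M"
  proof (rule maximum_modulus_frontier[of K "cball 0 1"])
    show "K holomorphic_on interior (cball 0 1)"
      using S(2) interior_subset by (intro holomorphic_on_subset[OF K]) blast
    show "continuous_on (closure (cball 0 1)) K"
      using S(2) by (intro holomorphic_on_imp_continuous_on holomorphic_on_subset[OF K]) simp
    fix z :: complex assume "z \<in> frontier (cball 0 1)"
    then have z: "norm z = 1" by simp
    then show "norm (K z) \<le> M" using FK[of z] M[OF z] b1[OF z] by simp
  qed (use w in auto)
  then show ?thesis unfolding FK[OF w] by (intro mult_left_mono prod_nonneg) auto
qed

subsection \<open>Smallness propagates from well separated nodes\<close>

text \<open>The \<open>a n\<close> are the Taylor coefficients of \<open>F\<close> at 0, so Cauchy's
  inequality on the circle of radius \<open>r\<close> applies.\<close>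

lemma power_series_coeff_le:
  fixes a :: "nat \<Rightarrow> complex"
  assumes sums: "\<And>w. norm w < R \<Longrightarrow> (\<lambda>n. a n * w ^ n) sums F w"
    and r: "0 < r" "r < R" and V: "\<And>w. norm w = r \<Longrightarrow> norm (F w) \<le> V"
  shows "norm (a n) * r ^ n \<le> V"
proof -
  have hol: "F holomorphic_on ball 0 R"
    using power_series_holomorphic[of 0 R a F] sums by simp
  have "F has_fps_expansion Abs_fps a"
    unfolding has_fps_expansion_def
  proof
    have "ereal R \<le> conv_radius a"
      by (intro conv_radius_geI_ex' sums_summable[OF sums]) auto
    then show "0 < fps_conv_radius (Abs_fps a)"
      using r by (auto simp: fps_conv_radius_def intro: less_le_trans[of 0 "ereal R"])
    show "\<forall>\<^sub>F z in nhds 0. eval_fps (Abs_fps a) z = F z"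
      using r sums by (intro eventually_nhds_in_open[of "ball 0 R", THEN eventually_mono])
        (auto simp: eval_fps_def sums_iff)
  qed
  from fps_nth_fps_expansion[OF this, of n] have "a n = (deriv ^^ n) F 0 / fact n" by simp
  moreover have "norm ((deriv ^^ n) F 0) \<le> fact n * V / r ^ n"
    using V r by (intro Cauchy_inequality holomorphic_on_imp_continuous_on holomorphic_on_subset[OF hol]) auto
  ultimately have "norm (a n) \<le> V / r ^ n"
    by (simp add: norm_divide pos_divide_le_eq mult.commute)
  then show ?thesis
    using r by (simp add: pos_le_divide_eq)
qed

text \<open>Subtract an interpolant \<open>L\<close>: the difference \<open>F - L\<close> vanishes
  at all nodes and gains one contraction factor per node by \<open>blaschke_schwarz\<close>, while
  \<open>L\<close> itself is of the size of the data times \<open>K\<close>.\<close>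

lemma small_at_nodes_imp_small:
  fixes s :: "nat \<Rightarrow> real"
  assumes S: "open S" "cball 0 1 \<subseteq> S" and F: "F holomorphic_on S"
    and M: "\<And>w. norm w = 1 \<Longrightarrow> norm (F w) \<le> M"
    and b: "0 \<le> b" "b < 1" and s: "\<And>i. i < n \<Longrightarrow> s i \<in> {0..b}"
    and \<eta>: "0 < \<eta>" "\<eta> \<le> 1"
    and sep: "\<And>i j. i < n \<Longrightarrow> j < n \<Longrightarrow> \<bar>real i - real j\<bar> * (\<eta> / real n) \<le> \<bar>s i - s j\<bar>"
    and \<epsilon>: "0 \<le> \<epsilon>" "\<And>i. i < n \<Longrightarrow> norm (F (of_real (s i))) \<le> \<epsilon>"
    and w: "norm w \<le> r" "r \<le> 1"
  shows "norm (F w) \<le> sqrt (1 - (1 - b\<^sup>2) * (1 - r\<^sup>2) / 4) ^ n * M + 2 * \<epsilon> * (4 * exp 1 / \<eta>) ^ n"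
proof -
  define q where "q = sqrt (1 - (1 - b\<^sup>2) * (1 - r\<^sup>2) / 4)"
  define K where "K = (4 * exp 1 / \<eta>) ^ n"
  have s1: "s i \<in> {0..<1}" if "i < n" for i using s[OF that] b by auto
  have inj: "inj_on s {..<n}"
  proof (rule inj_onI)
    fix i j assume ij: "i \<in> {..<n}" "j \<in> {..<n}" "s i = s j"
    then have "\<bar>real i - real j\<bar> * (\<eta> / real n) \<le> 0" "\<eta> / real n > 0"
      using sep[of i j] \<eta> by auto
    then show "i = j" using mult_le_0_iff[of "\<bar>real i - real j\<bar>" "\<eta> / real n"] by linarith
  qed
  \<comment> \<open>Lagrange interpolation with Blaschke factors in place of differences. The
    numerators have modulus at most 1 on the closed disc, so only the data and the denominators
    determine the size of \<open>L\<close> there.\<close>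
  define L where "L = (\<lambda>w. \<Sum>j<n. F (of_real (s j)) *
    (\<Prod>i\<in>{..<n} - {j}. blaschke (s i) w / blaschke (s i) (of_real (s j))))"
  have L_bound: "norm (L w) \<le> \<epsilon> * K" if w1: "norm w \<le> 1" for w
  proof -
    have "norm (\<Prod>i\<in>{..<n} - {j}. blaschke (s i) w / blaschke (s i) (of_real (s j))) \<le> (2 * exp 1 / \<eta>) ^ n"
      if j: "j < n" for j
    proof -
      have pos: "0 < (\<eta> / (2 * exp 1)) ^ n" using \<eta> by simp
      have "(\<eta> / (2 * exp 1)) ^ n \<le> (\<Prod>i\<in>{..<n} - {j}. \<bar>s i - s j\<bar>)"
        using prod_node_distance_ge[OF j \<eta>] sep j by blast
      also have "\<dots> \<le> (\<Prod>i\<in>{..<n} - {j}. norm (blaschke (s i) (of_real (s j))))"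
        using norm_blaschke_real_ge[OF s1[OF j] s1]
        by (intro prod_mono) (auto simp: abs_minus_commute[of _ "s j"])
      finally have *: "(\<eta> / (2 * exp 1)) ^ n \<le> (\<Prod>i\<in>{..<n} - {j}. norm (blaschke (s i) (of_real (s j))))" .
      have "(\<Prod>i\<in>{..<n} - {j}. norm (blaschke (s i) w)) \<le> 1"
        using s1 w1 by (intro prod_le_1) (auto intro: norm_blaschke_le_1)
      then have "(\<Prod>i\<in>{..<n} - {j}. norm (blaschke (s i) w)) / (\<Prod>i\<in>{..<n} - {j}. norm (blaschke (s i) (of_real (s j))))
          \<le> 1 / (\<eta> / (2 * exp 1)) ^ n"
        using * pos by (intro frac_le prod_nonneg) auto
      also have "\<dots> = (2 * exp 1 / \<eta>) ^ n" by (simp add: power_divide)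
      finally show ?thesis by (simp add: prod_norm[symmetric] norm_divide prod_dividef)
    qed
    then have "norm (L w) \<le> (\<Sum>j<n. \<epsilon> * (2 * exp 1 / \<eta>) ^ n)"
      unfolding L_def using \<epsilon>
      by (intro order_trans[OF norm_sum] sum_mono) (auto simp: norm_mult intro!: mult_mono)
    also have "\<dots> = \<epsilon> * (real n * (2 * exp 1 / \<eta>) ^ n)" by simp
    \<comment> \<open>The number of summands is absorbed by \<open>n \<le> 2 ^ n\<close>, which
      doubles the base.\<close>
    also have "\<dots> \<le> \<epsilon> * (2 ^ n * (2 * exp 1 / \<eta>) ^ n)"
      using \<epsilon>(1) \<eta> less_imp_le[OF of_nat_less_two_power[of n, where 'a = real]]
      by (intro mult_left_mono mult_right_mono) auto
    also have "\<dots> = \<epsilon> * K" unfolding K_def power_mult_distrib[symmetric] by simp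
    finally show ?thesis .
  qed
  have L_node: "L (of_real (s k)) = F (of_real (s k))" if k: "k < n" for k
  proof -
    have "(\<Prod>i\<in>{..<n} - {j}. blaschke (s i) (of_real (s k)) / blaschke (s i) (of_real (s j))) =
      (if j = k then 1 else 0)" if j: "j < n" for j
    proof (cases "j = k")
      case True
      have "blaschke (s i) (of_real (s k)) \<noteq> 0" if "i < n" "i \<noteq> k" for i
      proof -
        have "s i \<noteq> s k" using inj that k by (auto simp: inj_on_def)
        then show ?thesis using norm_blaschke_real_ge[of "s k" "s i"] s1 k that by auto
      qed
      then show ?thesis using True by auto
    next
      case False
      then have "k \<in> {..<n} - {j}" using k by auto
      moreover have "blaschke (s k) (of_real (s k)) = 0" by (simp add: blaschke_def)
      ultimately show ?thesis using False by (auto intro!: prod_zero)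
    qed
    then have "L (of_real (s k)) = (\<Sum>j<n. if j = k then F (of_real (s j)) else 0)"
      unfolding L_def by (intro sum.cong) auto
    then show ?thesis using k by simp
  qed
  \<comment> \<open>The poles of the Blaschke factors, at \<open>1 / s i\<close> for
    \<open>s i > 0\<close>, are at least \<open>1 / b\<close>. The half-plane excludes them and
    still contains the closed unit disc, as \<open>b < 1\<close>.\<close>
  define S' where "S' = S \<inter> {w. b * Re w < 1}"
  have S': "open S'" "cball 0 1 \<subseteq> S'"
  proof -
    show "open S'" unfolding S'_def using S by (intro open_Int open_Collect_less continuous_intros)
    have "b * Re w < 1" if "norm w \<le> 1" for w
      using mult_left_mono[of "Re w" 1 b] complex_Re_le_cmod[of w] that b by linarith
    then show "cball 0 1 \<subseteq> S'" using S by (auto simp: S'_def)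
  qed
  have "1 - of_real (s i) * w \<noteq> 0" if "w \<in> S'" "i < n" for w i
  proof
    assume "1 - of_real (s i) * w = 0"
    then have "Re (of_real (s i) * w) = Re 1" by (metis eq_iff_diff_eq_0)
    then have e: "s i * Re w = 1" by simp
    then have "0 < Re w" using s[OF that(2)] by (metis atLeastAtMost_iff mult_nonneg_nonpos not_le zero_less_one)
    then have "s i * Re w \<le> b * Re w" using s[OF that(2)] by (intro mult_right_mono) auto
    then show False using e that(1) by (simp add: S'_def)
  qed
  moreover have "blaschke (s i) (of_real (s j)) \<noteq> 0" if "i < n" "j < n" "i \<noteq> j" for i j
  proof -
    have "s i \<noteq> s j" using inj that by (auto simp: inj_on_def)
    then show ?thesis using norm_blaschke_real_ge[of "s j" "s i"] s1 that by auto
  qed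
  ultimately have "L holomorphic_on S'"
    unfolding L_def blaschke_def by (intro holomorphic_intros) (auto simp: blaschke_def)
  moreover have "F holomorphic_on S'" using F by (rule holomorphic_on_subset) (auto simp: S'_def)
  ultimately have hol: "(\<lambda>w. F w - L w) holomorphic_on S'" by (intro holomorphic_intros)
  have w1: "norm w \<le> 1" using w by simp
  have MK: "0 \<le> M + \<epsilon> * K"
    using order_trans[OF norm_ge_zero M[of 1]] order_trans[OF norm_ge_zero L_bound[of 0]] by simp
  have "norm (F w - L w) \<le> (\<Prod>i<n. norm (blaschke (s i) w)) * (M + \<epsilon> * K)"
  proof (rule blaschke_schwarz[OF S' hol inj s1])
    show "norm (F z - L z) \<le> M + \<epsilon> * K" if "norm z = 1" for z
      using norm_triangle_ineq4[of "F z" "L z"] M[OF that] L_bound[of z] that by simp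
  qed (use L_node w1 in auto)
  also have "\<dots> \<le> (\<Prod>i<n. q) * (M + \<epsilon> * K)"
    unfolding q_def using s b w MK by (intro mult_right_mono prod_mono) (auto intro: norm_blaschke_le)
  finally have FL: "norm (F w - L w) \<le> q ^ n * M + q ^ n * (\<epsilon> * K)" by (simp add: algebra_simps)
  have "q \<le> 1"
  proof -
    have "r\<^sup>2 \<le> 1" using w order_trans[OF norm_ge_zero w(1)] by (simp add: power_le_one)
    moreover have "b\<^sup>2 \<le> 1" using b by (simp add: power_le_one)
    ultimately show ?thesis by (simp add: q_def)
  qed
  moreover have "0 \<le> q"
  proof -
    have "r\<^sup>2 \<ge> 0" "r\<^sup>2 \<le> 1" using w order_trans[OF norm_ge_zero w(1)] by (simp_all add: power_le_one)
    moreover have "b\<^sup>2 \<le> 1" "b\<^sup>2 \<ge> 0" using b by (simp_all add: power_le_one)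
    ultimately have "(1 - b\<^sup>2) * (1 - r\<^sup>2) \<le> 1" by (intro mult_le_one) auto
    then show ?thesis by (simp add: q_def)
  qed
  \<comment> \<open>Dropping \<open>q ^ n\<close> in front of \<open>\<epsilon> * K\<close> makes
    this term occur once for \<open>F - L\<close> and once for \<open>L\<close>, hence the factor 2
    in the conclusion.\<close>
  ultimately have "q ^ n \<le> 1" by (simp add: power_le_one)
  moreover have "0 \<le> \<epsilon> * K" using \<epsilon> \<eta> by (simp add: K_def)
  ultimately have "q ^ n * (\<epsilon> * K) \<le> \<epsilon> * K" by (intro mult_left_le_one_le) (use \<open>0 \<le> q\<close> in auto)
  moreover have "norm (F w) \<le> norm (F w - L w) + norm (L w)"
    using norm_triangle_ineq[of "F w - L w" "L w"] by simp
  ultimately show ?thesis using FL L_bound[OF w1] unfolding q_def[symmetric] K_def[symmetric] by simp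
qed

text \<open>The slope of \<open>exp (- x)\<close> has modulus at least \<open>exp (- T)\<close> for
  \<open>x \<le> T\<close>. This carries the spacing of times over to the nodes
  \<open>exp (- t)\<close>.\<close>

lemma exp_neg_diff_ge:
  fixes x y T :: real
  assumes "x \<le> T" "y \<le> T"
  shows "exp (- T) * \<bar>x - y\<bar> \<le> \<bar>exp (- x) - exp (- y)\<bar>"
proof -
  have *: "exp (- T) * (v - u) \<le> exp (- u) - exp (- v)" if "u \<le> v" "v \<le> T" for u v :: real
  proof -
    have "exp (- T) * (v - u) \<le> exp (- v) * (exp (v - u) - 1)"
      using that exp_ge_add_one_self[of "v - u"] by (intro mult_mono) (auto simp: algebra_simps)
    also have "\<dots> = exp (- u) - exp (- v)" by (simp add: algebra_simps flip: exp_add)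
    finally show ?thesis .
  qed
  have "exp (- T) * \<bar>x - y\<bar> \<le> \<bar>exp (- x) - exp (- y)\<bar>" if "x \<le> y" "x \<le> T" "y \<le> T" for x y :: real
    using *[of x y] that by (simp add: abs_minus_commute[of x y])
  from this[of x y] this[of y x] show ?thesis
    using assms by (cases "x \<le> y") (auto simp: abs_minus_commute)
qed

text \<open>In the variable \<open>exp (- t)\<close> the sum is a power series that is small at
  separated nodes. After rescaling, the smallness spreads to the circle of radius 1/2, where
  Cauchy's inequality is applied; \<open>3 / 16\<close> is
  \<open>(1 - (1 / 2)\<^sup>2) / 4\<close>.\<close>

lemma exp_series_coeff_le:
  fixes a :: "nat \<Rightarrow> complex"
  assumes a: "summable (\<lambda>n. norm (a n))" "(\<Sum>n. norm (a n)) \<le> M"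
    and A: "A \<in> lmeasurable" "A \<subseteq> {\<tau>..T}" "0 < \<tau>" "0 < \<mu>" "\<mu> < measure lebesgue A"
    and small: "\<And>t. t \<in> A \<Longrightarrow> norm (\<Sum>n. exp (- real n * t) *\<^sub>R a n) \<le> \<epsilon>"
  shows "norm (a n) * (exp (- \<tau> / 2) / 2) ^ n \<le>
    sqrt (1 - (1 - exp (- \<tau>)) * 3 / 16) ^ N * M + 2 * \<epsilon> * (4 * exp 1 / min 1 (exp (- T) * \<mu>)) ^ N"
proof -
  \<comment> \<open>The square root of \<open>exp (- \<tau>)\<close> splits the available room:
    after division by \<open>R\<close> the nodes lie in \<open>{0..R}\<close>, and the rescaled
    series is holomorphic on the disc of radius \<open>1 / R\<close>, which exceeds 1.\<close>
  define R where "R = exp (- \<tau> / 2)"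
  define \<eta> where "\<eta> = min 1 (exp (- T) * \<mu>)"
  have R: "0 < R" "R < 1" "R * R = exp (- \<tau>)" using A by (auto simp: R_def simp flip: exp_add)
  have \<eta>: "0 < \<eta>" "\<eta> \<le> 1" using A by (auto simp: \<eta>_def)
  \<comment> \<open>For \<open>N = 0\<close> the left side is 0 by the convention on division by
    zero.\<close>
  have "real N * (\<mu> / real N) < measure lebesgue A" using A by (cases "N = 0") auto
  moreover have "bdd_below A" by (rule bdd_below_mono[OF bdd_below_Icc A(2)])
  ultimately obtain t where t: "\<And>i. i \<le> N \<Longrightarrow> t i \<in> A" "\<forall>i<N. t i + \<mu> / real N \<le> t (Suc i)"
    using spaced_points[OF A(1), of "\<mu> / real N" N] A by auto
  have tT: "\<tau> \<le> t i" "t i \<le> T" if "i \<le> N" for i using t(1)[OF that] A(2) by auto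
  define s where "s = (\<lambda>i. exp (- t i) / R)"
  define F where "F = (\<lambda>w. \<Sum>n. (a n * of_real R ^ n) * w ^ n)"
  have aw: "norm ((a n * of_real R ^ n) * w ^ n) \<le> norm (a n)" if "norm w \<le> 1 / R" for w n
  proof -
    have "norm (of_real R * w) \<le> 1" using that R by (simp add: norm_mult field_simps)
    then have "norm (of_real R * w) ^ n \<le> 1" by (intro power_le_one) auto
    then show ?thesis by (simp add: norm_mult norm_power power_mult_distrib mult.assoc mult_left_le)
  qed
  have sm: "summable (\<lambda>n. norm ((a n * of_real R ^ n) * w ^ n))" if "norm w \<le> 1 / R" for w
    using aw[OF that] by (intro summable_comparison_test'[OF a(1)]) auto
  have F_sums: "(\<lambda>n. (a n * of_real R ^ n) * w ^ n) sums F w" if "norm w < 1 / R" for w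
    unfolding F_def using that by (intro summable_sums summable_norm_cancel[OF sm]) auto
  have F_bound: "norm (F w) \<le> M" if "norm w = 1" for w
  proof -
    have w: "norm w \<le> 1 / R" using that R by simp
    have "norm (F w) \<le> (\<Sum>n. norm ((a n * of_real R ^ n) * w ^ n))"
      unfolding F_def by (rule summable_norm[OF sm[OF w]])
    also have "\<dots> \<le> (\<Sum>n. norm (a n))" by (intro suminf_le aw w sm a)
    finally show ?thesis using a by simp
  qed
  have F_exp: "F (of_real (exp (- t) / R)) = (\<Sum>n. exp (- real n * t) *\<^sub>R a n)" for t
  proof -
    have "exp (- real n * t) = exp (- t) ^ n" for n by (simp flip: exp_of_nat_mult)
    then show ?thesis unfolding F_def using R
      by (simp add: power_divide scaleR_conv_of_real mult.commute)
  qed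
  have circle: "norm (F w) \<le> sqrt (1 - (1 - R\<^sup>2) * (1 - (1 / 2)\<^sup>2) / 4) ^ N * M + 2 * \<epsilon> * (4 * exp 1 / \<eta>) ^ N"
    if w: "norm w = 1 / 2" for w
  proof (rule small_at_nodes_imp_small[where F = F and w = w and S = "ball 0 (1 / R)" and s = s])
    have "1 < 1 / R" using R by simp
    then show "cball (0::complex) 1 \<subseteq> ball 0 (1 / R)" by auto
    show "F holomorphic_on ball 0 (1 / R)"
      using F_sums by (intro power_series_holomorphic[where a = "\<lambda>n. a n * of_real R ^ n"]) simp
    show "s i \<in> {0..R}" if "i < N" for i
      using tT[of i] that R by (simp add: s_def pos_divide_le_eq)
    show "\<bar>real i - real j\<bar> * (\<eta> / real N) \<le> \<bar>s i - s j\<bar>" if "i < N" "j < N" for i j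
    proof -
      have "\<bar>real i - real j\<bar> * (\<eta> / real N) \<le> \<bar>real i - real j\<bar> * (exp (- T) * \<mu> / real N)"
        by (intro mult_left_mono divide_right_mono) (auto simp: \<eta>_def)
      also have "\<dots> = exp (- T) * (\<bar>real i - real j\<bar> * (\<mu> / real N))" by simp
      also have "\<dots> \<le> exp (- T) * \<bar>t i - t j\<bar>"
        using spaced_points_dist[OF t(2), of i j] that by (intro mult_left_mono) auto
      also have "\<dots> \<le> \<bar>exp (- t i) - exp (- t j)\<bar>"
        using tT that by (intro exp_neg_diff_ge) auto
      also have "\<dots> \<le> \<bar>exp (- t i) - exp (- t j)\<bar> / R"
        using R by (simp add: le_divide_eq mult_left_le)
      also have "\<dots> = \<bar>s i - s j\<bar>" using R by (simp add: s_def abs_divide flip: diff_divide_distrib)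
      finally show ?thesis .
    qed
    \<comment> \<open>The point \<open>t 0\<close> exists even for \<open>N = 0\<close>, since
      \<open>spaced_points\<close> returns one point more than there are gaps.\<close>
    show "0 \<le> \<epsilon>" using small[OF t(1)[of 0]] norm_ge_zero order_trans by blast
    show "norm (F (of_real (s i))) \<le> \<epsilon>" if "i < N" for i
      unfolding s_def F_exp using small t(1) that by simp
  qed (use w R(1,2) \<eta> F_bound in simp_all)
  have "norm (a n * of_real R ^ n) * (1 / 2) ^ n \<le>
      sqrt (1 - (1 - R\<^sup>2) * (1 - (1 / 2)\<^sup>2) / 4) ^ N * M + 2 * \<epsilon> * (4 * exp 1 / \<eta>) ^ N"
    by (rule power_series_coeff_le[where R = "1 / R" and F = F, OF F_sums _ _ circle])
      (use R(1,2) in \<open>simp_all add: less_divide_eq\<close>)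
  moreover have "norm (a n * of_real R ^ n) * (1 / 2) ^ n = norm (a n) * (R / 2) ^ n"
    using R by (simp add: norm_mult norm_power power_divide)
  moreover have "1 - (1 - R\<^sup>2) * (1 - (1 / 2)\<^sup>2) / 4 = 1 - (1 - exp (- \<tau>)) * 3 / 16"
    using R by (simp add: power2_eq_square)
  ultimately show ?thesis by (simp only: R_def \<eta>_def)
qed

subsection \<open>Sine coefficients of H2 functions\<close>

text \<open>By \<open>heat_sol_initial\<close> the sine series represents \<open>f\<close> almost
  everywhere. It is multiplied by the conjugate of \<open>f\<close> and integrated term by term,
  which the absolute summability of the coefficients permits.\<close>

lemma parseval_sine:
  assumes f: "H_fun 2 f"
  shows "(\<lambda>k. (pi / 2) * (norm (sine_coeff f (Suc k)))\<^sup>2) sums (L2_norm f)\<^sup>2"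
proof -
  define a where "a = (\<lambda>k. sine_coeff f (Suc k))"
  have f1: "integrable leb_pi f" and f2: "integrable leb_pi (\<lambda>x. (norm (f x))\<^sup>2)"
    using f by (auto simp: H_fun_def L2_fun_integrable L2_fun_def)
  define I where "I = (\<integral>x. norm (f x) \<partial>leb_pi)"
  have sa: "summable (\<lambda>k. norm (a k))" unfolding a_def by (rule H_fun_summable[OF f])
  define g where "g = (\<lambda>k x. a k * cnj (sin (real (Suc k) * x) *\<^sub>R f x))"
  have isf: "integrable leb_pi (\<lambda>x. sin (real (Suc k) * x) *\<^sub>R f x)" for k
    by (rule integrable_sin_mult[OF f1])
  have g1: "integrable leb_pi (g k)" for k
    unfolding g_def by (rule integrable_mult_right[OF integrable_cnj[OF isf]])
  have gn: "norm (g k x) \<le> norm (a k) * norm (f x)" for k x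
    by (simp add: g_def norm_mult mult_left_le_one_le mult_left_mono del: of_nat_Suc)
  have "(\<lambda>k. \<integral>x. g k x \<partial>leb_pi) sums (\<integral>x. (\<Sum>k. g k x) \<partial>leb_pi)"
  proof (rule sums_integral[OF g1])
    show "AE x in leb_pi. summable (\<lambda>k. norm (g k x))"
      using gn by (intro AE_I2 summable_comparison_test'[OF summable_mult2[OF sa]]) auto
    show "summable (\<lambda>k. \<integral>x. norm (g k x) \<partial>leb_pi)"
    proof (rule summable_comparison_test'[OF summable_mult2[OF sa, of I]])
      fix k
      have "(\<integral>x. norm (g k x) \<partial>leb_pi) \<le> (\<integral>x. norm (a k) * norm (f x) \<partial>leb_pi)"
        using g1 gn f1 by (intro integral_mono integrable_norm) auto
      then show "norm (\<integral>x. norm (g k x) \<partial>leb_pi) \<le> norm (a k) * I" by (simp add: I_def)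
    qed
  qed
  moreover have "(\<integral>x. g k x \<partial>leb_pi) = of_real ((pi / 2) * (norm (a k))\<^sup>2)" for k
  proof -
    have "(\<integral>x. g k x \<partial>leb_pi) = a k * cnj (\<integral>x. sin (real (Suc k) * x) *\<^sub>R f x \<partial>leb_pi)"
      unfolding g_def by (simp only: integral_mult_right_zero Bochner_Integration.integral_cnj)
    also have "(\<integral>x. sin (real (Suc k) * x) *\<^sub>R f x \<partial>leb_pi) = (pi / 2) *\<^sub>R a k"
      by (simp add: a_def sine_coeff_def)
    also have "a k * cnj ((pi / 2) *\<^sub>R a k) = of_real (pi / 2) * (a k * cnj (a k))"
      by (simp add: scaleR_conv_of_real)
    finally show ?thesis by (simp only: complex_norm_square[symmetric] of_real_mult)
  qed
  moreover have "(\<integral>x. (\<Sum>k. g k x) \<partial>leb_pi) = (\<integral>x. complex_of_real ((norm (f x))\<^sup>2) \<partial>leb_pi)"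
  proof (rule integral_cong_AE)
    show "AE x in leb_pi. (\<Sum>k. g k x) = complex_of_real ((norm (f x))\<^sup>2)"
      using heat_sol_initial[OF f]
    proof eventually_elim
      fix x assume h: "heat_sol f x 0 = f x"
      have "summable (\<lambda>k. sin (real (Suc k) * x) *\<^sub>R a k)"
        by (rule summable_comparison_test'[OF sa]) (simp add: mult_left_le_one_le del: of_nat_Suc)
      then have "(\<lambda>k. sin (real (Suc k) * x) *\<^sub>R a k) sums f x"
        using h by (simp add: heat_sol_def a_def sums_iff)
      then have "(\<lambda>k. (sin (real (Suc k) * x) *\<^sub>R a k) * cnj (f x)) sums (f x * cnj (f x))"
        by (rule sums_mult2)
      then have "(\<lambda>k. g k x) sums (f x * cnj (f x))"
        by (simp add: g_def scaleR_conv_of_real mult_ac del: of_nat_Suc)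
      then show "(\<Sum>k. g k x) = complex_of_real ((norm (f x))\<^sup>2)"
        unfolding complex_norm_square by (rule sums_unique[symmetric])
    qed
    show "(\<lambda>x. complex_of_real ((norm (f x))\<^sup>2)) \<in> borel_measurable leb_pi"
      using borel_measurable_integrable[OF f2] by measurable
    show "(\<lambda>x. \<Sum>k. g k x) \<in> borel_measurable leb_pi"
      using borel_measurable_integrable[OF g1] by measurable
  qed
  moreover have "(\<integral>x. complex_of_real ((norm (f x))\<^sup>2) \<partial>leb_pi) = of_real ((L2_norm f)\<^sup>2)"
    by (simp only: L2_norm_def integral_complex_of_real) (simp add: integral_nonneg_AE)
  ultimately show ?thesis by (simp only: sums_of_real_iff a_def)
qed

text \<open>The Sobolev weight dominates \<open>real (Suc k) ^ 4\<close>, so single coefficients and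
  the tail of frequencies above \<open>N\<close> can be read off the weighted sum.\<close>

lemma H2_coeff_bounds:
  assumes f: "H_fun 2 f" "H_norm 2 f \<le> m"
  shows "norm (sine_coeff f (Suc k)) \<le> m / (real (Suc k))\<^sup>2"
    and "1 \<le> N \<Longrightarrow> (\<Sum>k. (norm (sine_coeff f (Suc (k + N))))\<^sup>2) \<le> (m / (real N)\<^sup>2)\<^sup>2"
    and "summable (\<lambda>k. (norm (sine_coeff f (Suc k)))\<^sup>2)"
proof -
  define c where "c = (\<lambda>k. (norm (sine_coeff f (Suc k)))\<^sup>2)"
  define W where "W = (\<lambda>k. bracket (Suc k) powr (2 * 2) * c k)"
  have W: "summable W" using f(1) by (simp add: H_fun_def W_def c_def)
  have c0: "0 \<le> c k" for k by (simp add: c_def)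
  have W0: "0 \<le> W k" for k by (simp add: W_def c0)
  have "0 \<le> suminf W" using W W0 by (intro suminf_nonneg)
  moreover have "H_norm 2 f = sqrt (suminf W)" by (simp add: H_norm_def W_def c_def)
  ultimately have m0: "0 \<le> m" and Wm: "suminf W \<le> m\<^sup>2"
    using f(2) sqrt_le_D[of "suminf W" m] order_trans[OF real_sqrt_ge_zero[of "suminf W"]] by auto
  have W_ge: "real (Suc k) ^ 4 * c k \<le> W k" for k
  proof -
    have b: "real (Suc k) \<le> bracket (Suc k)" unfolding bracket_def by (intro real_le_rsqrt) auto
    then have b0: "0 < bracket (Suc k)" by (rule less_le_trans[rotated]) simp
    then have "bracket (Suc k) powr (2 * 2) = bracket (Suc k) ^ 4"
      using powr_realpow[OF b0, of 4] by simp
    then show ?thesis unfolding W_def using b c0 by (intro mult_right_mono) (auto intro: power_mono)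
  qed
  have c_le: "c k \<le> W k" for k
  proof -
    have "1 * c k \<le> real (Suc k) ^ 4 * c k" using c0 by (intro mult_right_mono one_le_power) auto
    then show ?thesis using W_ge[of k] by simp
  qed
  show sc: "summable (\<lambda>k. (norm (sine_coeff f (Suc k)))\<^sup>2)"
    using c_le c0 unfolding c_def[symmetric] by (intro summable_comparison_test'[OF W]) auto
  show "norm (sine_coeff f (Suc k)) \<le> m / (real (Suc k))\<^sup>2"
  proof -
    have "W k \<le> suminf W" using sum_le_suminf[OF W, of "{k}"] W0 by simp
    then have "((real (Suc k))\<^sup>2 * norm (sine_coeff f (Suc k)))\<^sup>2 \<le> m\<^sup>2"
      using W_ge[of k] Wm by (simp add: c_def power_mult_distrib flip: power_mult)
    then have "(real (Suc k))\<^sup>2 * norm (sine_coeff f (Suc k)) \<le> m" using m0 by (rule power2_le_imp_le)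
    then show ?thesis by (simp add: field_simps)
  qed
  show "(\<Sum>k. (norm (sine_coeff f (Suc (k + N))))\<^sup>2) \<le> (m / (real N)\<^sup>2)\<^sup>2" if N: "1 \<le> N"
  proof -
    have s1: "summable (\<lambda>k. W (k + N))" using W by (rule summable_ignore_initial_segment)
    have "(\<Sum>k. c (k + N)) \<le> (\<Sum>k. W (k + N) / real N ^ 4)"
    proof (rule suminf_le)
      fix k
      have "real N ^ 4 * c (k + N) \<le> real (Suc (k + N)) ^ 4 * c (k + N)"
        using c0 by (intro mult_right_mono power_mono) auto
      also have "\<dots> \<le> W (k + N)" by (rule W_ge)
      finally show "c (k + N) \<le> W (k + N) / real N ^ 4" using N by (simp add: field_simps)
    next
      show "summable (\<lambda>k. c (k + N))" using sc unfolding c_def[symmetric] by (rule summable_ignore_initial_segment)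
      show "summable (\<lambda>k. W (k + N) / real N ^ 4)" using s1 by (rule summable_divide)
    qed
    also have "\<dots> = (\<Sum>k. W (k + N)) / real N ^ 4" using s1 by (rule suminf_divide)
    also have "(\<Sum>k. W (k + N)) \<le> suminf W"
      using suminf_split_initial_segment[OF W, of N] sum_nonneg[of "{..<N}" W] W0 by simp
    also have "suminf W \<le> m\<^sup>2" by (rule Wm)
    finally show ?thesis by (simp add: c_def power_divide divide_right_mono flip: power_mult)
  qed
qed

subsection \<open>Cutting off high frequencies\<close>

lemma summable_inverse_squares_Suc: "summable (\<lambda>k. 1 / (real (Suc k))\<^sup>2)"
proof -
  have "summable (\<lambda>n. inverse ((real n)\<^sup>2))" by (rule inverse_power_summable) simp
  then show ?thesis
    by (subst (asm) summable_Suc_iff[symmetric]) (simp add: inverse_eq_divide)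
qed

text \<open>Only the exponents \<open>(Suc k)\<^sup>2\<close> occur in the solution at
  \<open>x0\<close>. Filling the others with zeros gives a series for
  \<open>exp_series_coeff_le\<close>, whose absolute sum is controlled by the decay
  \<open>m / (real (Suc k))\<^sup>2\<close>.\<close>

lemma heat_coeff_le:
  assumes f: "H_fun 2 f" "H_norm 2 f \<le> m"
    and A: "A \<in> lmeasurable" "A \<subseteq> {\<tau>..T}" "0 < \<tau>" "0 < \<mu>" "\<mu> < measure lebesgue A"
    and small: "\<And>t. t \<in> A \<Longrightarrow> norm (heat_sol f x0 t) \<le> \<epsilon>"
  shows "\<bar>sin (real (Suc k) * x0)\<bar> * norm (sine_coeff f (Suc k)) * (exp (- \<tau> / 2) / 2) ^ (Suc k)\<^sup>2 \<le>
    sqrt (1 - (1 - exp (- \<tau>)) * 3 / 16) ^ n * (m * (\<Sum>k. 1 / (real (Suc k))\<^sup>2)) +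
    2 * \<epsilon> * (4 * exp 1 / min 1 (exp (- T) * \<mu>)) ^ n"
proof -
  define c where "c = (\<lambda>k. sin (real (Suc k) * x0) *\<^sub>R sine_coeff f (Suc k))"
  define g where "g = (\<lambda>k::nat. (Suc k)\<^sup>2)"
  have g: "strict_mono g" unfolding g_def by (intro strict_monoI power_strict_mono) auto
  then have inv: "inv g (g k) = k" for k by (simp add: inv_f_f strict_mono_imp_inj_on)
  define a where "a = (\<lambda>n. if n \<in> range g then c (inv g n) else 0)"
  have ag: "a (g k) = c k" for k by (simp add: a_def inv)
  \<comment> \<open>Passing between the sparse and the filled series is stated for a general
    \<open>F\<close>, as it is needed for the norms and for the exponential terms.\<close>
  have sums_a: "(\<lambda>k. F (g k) (c k)) sums S \<longleftrightarrow> (\<lambda>n. F n (a n)) sums S"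
    if "\<And>n. F n 0 = 0" for F :: "nat \<Rightarrow> complex \<Rightarrow> 'b::real_normed_vector" and S
    using sums_mono_reindex[OF g, of "\<lambda>n. F n (a n)" S] that unfolding ag by (simp add: a_def)
  note sq = summable_inverse_squares_Suc
  have c_le: "norm (c k) \<le> m * (1 / (real (Suc k))\<^sup>2)" for k
  proof -
    have "norm (c k) \<le> norm (sine_coeff f (Suc k))"
      by (simp add: c_def mult_left_le_one_le del: of_nat_Suc)
    also have "\<dots> \<le> m * (1 / (real (Suc k))\<^sup>2)" using H2_coeff_bounds(1)[OF f, of k] by simp
    finally show ?thesis .
  qed
  have sc: "summable (\<lambda>k. norm (c k))"
    using c_le by (intro summable_comparison_test'[OF summable_mult[OF sq, of m]]) simp
  have "(\<Sum>k. norm (c k)) \<le> (\<Sum>k. m * (1 / (real (Suc k))\<^sup>2))"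
    by (intro suminf_le c_le sc summable_mult sq)
  then have "(\<Sum>k. norm (c k)) \<le> m * (\<Sum>k. 1 / (real (Suc k))\<^sup>2)"
    by (simp only: suminf_mult[OF sq])
  moreover have "(\<lambda>n. norm (a n)) sums (\<Sum>k. norm (c k))"
    using sums_a[of "\<lambda>n. norm"] summable_sums[OF sc] by simp
  ultimately have a: "summable (\<lambda>n. norm (a n))" "(\<Sum>n. norm (a n)) \<le> m * (\<Sum>k. 1 / (real (Suc k))\<^sup>2)"
    by (auto simp: sums_iff)
  have bound: "norm (\<Sum>n. exp (- real n * t) *\<^sub>R a n) \<le> \<epsilon>" if t: "t \<in> A" for t
  proof -
    have "t \<ge> 0" using t A by auto
    then have "norm (exp (- real n * t) *\<^sub>R a n) \<le> norm (a n)" for n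
      by (simp add: mult_left_le_one_le)
    then have "summable (\<lambda>n. exp (- real n * t) *\<^sub>R a n)"
      by (intro summable_comparison_test'[OF a(1)]) auto
    then have "(\<lambda>k. exp (- real (g k) * t) *\<^sub>R c k) sums (\<Sum>n. exp (- real n * t) *\<^sub>R a n)"
      using sums_a[of "\<lambda>n z. exp (- real n * t) *\<^sub>R z"] by (simp add: summable_sums)
    moreover have "exp (- real (g k) * t) *\<^sub>R c k =
      (exp (- (real (Suc k))\<^sup>2 * t) * sin (real (Suc k) * x0)) *\<^sub>R sine_coeff f (Suc k)" for k
      by (simp add: g_def c_def del: of_nat_Suc)
    ultimately have "heat_sol f x0 t = (\<Sum>n. exp (- real n * t) *\<^sub>R a n)"
      by (simp only: heat_sol_def sums_iff)
    then show ?thesis using small[OF t] by simp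
  qed
  have "norm (a (g k)) * (exp (- \<tau> / 2) / 2) ^ g k \<le>
    sqrt (1 - (1 - exp (- \<tau>)) * 3 / 16) ^ n * (m * (\<Sum>k. 1 / (real (Suc k))\<^sup>2)) +
    2 * \<epsilon> * (4 * exp 1 / min 1 (exp (- T) * \<mu>)) ^ n"
    by (rule exp_series_coeff_le[OF a A bound])
  then show ?thesis unfolding ag by (simp only: c_def norm_scaleR real_norm_def g_def)
qed

text \<open>Parseval's identity is split at \<open>N\<close>. The \<open>N\<close> low coefficients
  contribute at most \<open>real N ^ 3 * D\<^sup>2\<close>, the tail is bounded by
  \<open>H2_coeff_bounds\<close>, and \<open>pi / 2 \<le> 2\<close>.\<close>

lemma L2_norm_le_head_tail:
  assumes f: "H_fun 2 f" "H_norm 2 f \<le> m" and N: "1 \<le> N"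
    and D: "\<And>k. k < N \<Longrightarrow> norm (sine_coeff f (Suc k)) \<le> real N * D" and D0: "0 \<le> D" and m: "0 \<le> m"
  shows "L2_norm f \<le> 2 * ((real N)\<^sup>2 * D + m / (real N)\<^sup>2)"
proof (rule power2_le_imp_le)
  define c where "c = (\<lambda>k. (norm (sine_coeff f (Suc k)))\<^sup>2)"
  have "summable c" using H2_coeff_bounds(3)[OF f] by (simp add: c_def)
  have "(L2_norm f)\<^sup>2 = (pi / 2) * suminf c"
    using parseval_sine[OF f(1)] suminf_mult[OF \<open>summable c\<close>, of "pi / 2"] by (simp add: sums_iff c_def)
  also have "suminf c = (\<Sum>k. c (k + N)) + (\<Sum>k<N. c k)"
    by (rule suminf_split_initial_segment[OF \<open>summable c\<close>])
  also have "(pi / 2) * \<dots> \<le> 2 * ((m / (real N)\<^sup>2)\<^sup>2 + ((real N)\<^sup>2 * D)\<^sup>2)"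
  proof (rule mult_mono)
    have "(\<Sum>k<N. c k) \<le> (\<Sum>k<N. (real N * D)\<^sup>2)"
      unfolding c_def by (intro sum_mono power_mono) (auto intro: D)
    also have "\<dots> = real N ^ 3 * D\<^sup>2" by (simp add: power2_eq_square power3_eq_cube)
    also have "\<dots> \<le> real N ^ 4 * D\<^sup>2" using N by (intro mult_right_mono power_increasing) auto
    also have "\<dots> = ((real N)\<^sup>2 * D)\<^sup>2" by (simp add: power_mult_distrib flip: power_mult)
    finally show "(\<Sum>k. c (k + N)) + (\<Sum>k<N. c k) \<le> (m / (real N)\<^sup>2)\<^sup>2 + ((real N)\<^sup>2 * D)\<^sup>2"
      using H2_coeff_bounds(2)[OF f N] by (simp add: c_def)
    show "0 \<le> (\<Sum>k. c (k + N)) + (\<Sum>k<N. c k)"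
      using \<open>summable c\<close> by (intro add_nonneg_nonneg suminf_nonneg sum_nonneg summable_ignore_initial_segment)
        (auto simp: c_def)
  qed (use pi_less_4 in auto)
  also have "\<dots> \<le> (2 * ((real N)\<^sup>2 * D + m / (real N)\<^sup>2))\<^sup>2"
  proof -
    have "2 * (v\<^sup>2 + u\<^sup>2) \<le> (2 * (u + v))\<^sup>2" if "0 \<le> u" "0 \<le> v" for u v :: real
      using mult_nonneg_nonneg[OF that] by (simp add: power2_eq_square algebra_simps)
    from this[of "(real N)\<^sup>2 * D" "m / (real N)\<^sup>2"] show ?thesis using D0 m by simp
  qed
  finally show "(L2_norm f)\<^sup>2 \<le> (2 * ((real N)\<^sup>2 * D + m / (real N)\<^sup>2))\<^sup>2" .
qed (use D0 m in simp)

text \<open>With a number of nodes proportional to \<open>N\<^sup>2\<close>,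
  \<open>heat_coeff_le\<close> controls all frequencies up to \<open>N\<close>. The constants are
  fixed before \<open>f\<close>, \<open>\<epsilon>\<close> and \<open>N\<close>.\<close>

lemma L2_norm_le_frequency_cutoff:
  assumes d0: "0 < d0" "\<And>k::nat. 1 \<le> k \<Longrightarrow> d0 * inverse (real k) \<le> \<bar>sin (real k * x0)\<bar>"
    and B: "B \<subseteq> {0..T}" "B \<in> sets lebesgue" "0 < emeasure lebesgue B" and m: "0 < m"
  shows "\<exists>C \<Lambda>. 0 < C \<and> 1 < \<Lambda> \<and> (\<forall>f \<epsilon> N. H_fun 2 f \<and> H_norm 2 f \<le> m \<and> 0 \<le> \<epsilon> \<and>
    (AE t in lebesgue_on B. norm (heat_sol f x0 t) \<le> \<epsilon>) \<and> 1 \<le> N \<longrightarrow>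
    L2_norm f \<le> C * (1 / (real N)\<^sup>2 + \<epsilon> * \<Lambda> ^ N\<^sup>2))"
proof -
  have Bl: "B \<in> lmeasurable"
    using B by (intro bounded_set_imp_lmeasurable bounded_subset[OF bounded_closed_interval])
  have mB: "0 < measure lebesgue B"
    using B(3) unfolding emeasure_eq_measure2[OF Bl] by (simp only: ennreal_less_zero_iff)
  \<comment> \<open>Discarding the times up to \<open>\<tau>\<close> costs at most half of the
    measure of \<open>B\<close>; a quarter, \<open>\<mu>\<close>, is then strictly below what
    remains.\<close>
  define \<tau> where "\<tau> = measure lebesgue B / 2"
  define \<mu> where "\<mu> = measure lebesgue B / 4"
  have \<tau>: "0 < \<tau>" "0 < \<mu>" using mB by (auto simp: \<tau>_def \<mu>_def)
  define \<rho> where "\<rho> = exp (- \<tau> / 2) / 2"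
  define q where "q = sqrt (1 - (1 - exp (- \<tau>)) * 3 / 16)"
  define K where "K = 4 * exp 1 / min 1 (exp (- T) * \<mu>)"
  define S where "S = (\<Sum>k. 1 / (real (Suc k))\<^sup>2)"
  have \<rho>: "0 < \<rho>" "\<rho> \<le> 1" using \<tau> by (auto simp: \<rho>_def intro: order_trans[of _ "exp 0"])
  have q: "0 \<le> q" "q < 1"
  proof -
    have "0 < exp (- \<tau>)" "exp (- \<tau>) < 1" using \<tau> by simp_all
    then have "0 \<le> 1 - (1 - exp (- \<tau>)) * 3 / 16" and "1 - (1 - exp (- \<tau>)) * 3 / 16 < 1"
      by (auto simp: field_simps)
    then show "0 \<le> q" "q < 1" unfolding q_def by (simp_all only: real_sqrt_ge_zero real_sqrt_lt_1_iff)
  qed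
  have "1 \<le> K"
  proof -
    have "min 1 (exp (- T) * \<mu>) \<le> 4 * exp 1" using exp_ge_add_one_self[of 1] by linarith
    then show ?thesis using \<tau> by (simp add: K_def)
  qed
  have "0 \<le> S" unfolding S_def by (rule suminf_nonneg[OF summable_inverse_squares_Suc]) simp
  \<comment> \<open>With \<open>J * N\<^sup>2\<close> nodes the interpolation error outweighs the
    later division by \<open>\<rho> ^ N\<^sup>2\<close> and still leaves a factor
    \<open>(1 / 4) ^ N\<^sup>2\<close>.\<close>
  obtain J where J: "q ^ J < \<rho> / 4" using real_arch_pow_inv[of "\<rho> / 4" q] \<rho> q by auto
  \<comment> \<open>The factor 2 absorbs the weight \<open>N\<^sup>2\<close> of the low frequencies
    through \<open>N\<^sup>2 \<le> 2 ^ N\<^sup>2\<close>.\<close>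
  define \<Lambda> where "\<Lambda> = 2 * (K ^ J / \<rho>)"
  have \<Lambda>: "1 \<le> K ^ J / \<rho>" using \<rho> one_le_power[OF \<open>1 \<le> K\<close>, of J] by (simp add: field_simps)
  define C where "C = 2 * ((m * S + 2) / d0 + m)"
  have mS: "0 \<le> m * S" using m \<open>0 \<le> S\<close> by simp
  have "L2_norm f \<le> C * (1 / (real N)\<^sup>2 + \<epsilon> * \<Lambda> ^ N\<^sup>2)"
    if f: "H_fun 2 f" "H_norm 2 f \<le> m" and \<epsilon>: "0 \<le> \<epsilon>"
      "AE t in lebesgue_on B. norm (heat_sol f x0 t) \<le> \<epsilon>" and N: "1 \<le> N" for f \<epsilon> N
  proof -
    define x where "x = N\<^sup>2"
    have x: "1 \<le> x" using N by (simp add: x_def)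
    have "AE t in lebesgue. t \<in> B \<longrightarrow> norm (heat_sol f x0 t) \<le> \<epsilon>"
      using \<epsilon>(2) B(2) by (subst (asm) AE_restrict_space_iff) auto
    then obtain Z where Z: "Z \<in> null_sets lebesgue" "{t. \<not> (t \<in> B \<longrightarrow> norm (heat_sol f x0 t) \<le> \<epsilon>)} \<subseteq> Z"
      unfolding eventually_ae_filter by auto
    \<comment> \<open>Removing the null set \<open>Z\<close> makes the bound hold at every remaining
      time, so that any of them can serve as a node.\<close>
    define A where "A = (B - {0..\<tau>}) - Z"
    have A1: "B - {0..\<tau>} \<in> lmeasurable" using Bl by (intro fmeasurable.Diff) auto
    have A: "A \<in> lmeasurable" unfolding A_def by (rule fmeasurable_Diff[OF A1 null_setsD2[OF Z(1)]])
    have mA: "measure lebesgue A = measure lebesgue (B - {0..\<tau>})"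
      unfolding A_def by (intro measure_Diff_null_set fmeasurableD A1 Z(1))
    have "measure lebesgue B \<le> measure lebesgue ((B - {0..\<tau>}) \<union> {0..\<tau>})"
      using A1 Bl by (intro measure_mono_fmeasurable fmeasurable.Un fmeasurableD) auto
    also have "\<dots> \<le> measure lebesgue (B - {0..\<tau>}) + measure lebesgue {0..\<tau>}"
      using A1 by (intro measure_Un_le fmeasurableD) auto
    finally have \<mu>A: "\<mu> < measure lebesgue A" using \<tau> mB by (simp add: mA \<tau>_def \<mu>_def)
    have AT: "A \<subseteq> {\<tau>..T}" using B(1) by (auto simp: A_def)
    have small: "norm (heat_sol f x0 t) \<le> \<epsilon>" if "t \<in> A" for t using that Z(2) by (auto simp: A_def)
    define E where "E = (1 / 4) ^ x * (m * S) + 2 * \<epsilon> * (K ^ J / \<rho>) ^ x"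
    have E: "0 \<le> E" using mS \<epsilon> \<Lambda> by (simp add: E_def)
    have co: "norm (sine_coeff f (Suc k)) \<le> real N * (E / d0)" if k: "k < N" for k
    proof -
      define s where "s = \<bar>sin (real (Suc k) * x0)\<bar> * norm (sine_coeff f (Suc k))"
      have s0: "0 \<le> s" by (simp add: s_def)
      have kx: "(Suc k)\<^sup>2 \<le> x" using k unfolding x_def by (intro power_mono) auto
      \<comment> \<open>The weight \<open>\<rho> ^ x\<close> is the worst among the frequencies up
        to \<open>N\<close>, so the same \<open>E\<close> serves all of them.\<close>
      have "s * \<rho> ^ x \<le> s * \<rho> ^ (Suc k)\<^sup>2"
        using s0 \<rho> kx by (intro mult_left_mono power_decreasing) auto
      also have "\<dots> \<le> q ^ (J * x) * (m * S) + 2 * \<epsilon> * K ^ (J * x)"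
        using heat_coeff_le[OF f A AT \<tau> \<mu>A small, of k "J * x"]
        unfolding s_def q_def K_def \<rho>_def S_def by simp
      also have "\<dots> \<le> (\<rho> / 4) ^ x * (m * S) + 2 * \<epsilon> * (K ^ J) ^ x"
        using J q mS by (auto simp: power_mult intro!: mult_right_mono power_mono)
      also have "\<dots> = E * \<rho> ^ x"
        using \<rho> by (simp add: E_def power_divide distrib_right)
      finally have sE: "s \<le> E" using \<rho> by simp
      \<comment> \<open>The lower bound on the sine at \<open>x0\<close> costs a factor
        \<open>Suc k\<close>, at most \<open>N\<close>.\<close>
      have "d0 * norm (sine_coeff f (Suc k)) = real (Suc k) * (d0 * inverse (real (Suc k)) * norm (sine_coeff f (Suc k)))"
        by simp
      also have "\<dots> \<le> real (Suc k) * s"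
        unfolding s_def using d0(2)[of "Suc k"] by (intro mult_left_mono mult_right_mono) auto
      also have "\<dots> \<le> real N * E" using sE s0 k by (intro mult_mono) auto
      finally show ?thesis using d0 by (simp add: pos_le_divide_eq mult.commute)
    qed
    have "L2_norm f \<le> 2 * ((real N)\<^sup>2 * (E / d0) + m / (real N)\<^sup>2)"
      by (rule L2_norm_le_head_tail[OF f N co]) (use E d0 m in auto)
    also have "\<dots> = 2 * (real x * E / d0 + m / real x)" by (simp add: x_def)
    also have "\<dots> \<le> 2 * ((m * S / real x + 2 * (\<epsilon> * \<Lambda> ^ x)) / d0 + m / real x)"
    proof -
      have x2: "real x \<le> 2 ^ x" using of_nat_less_two_power[of x, where 'a = real] by simp
      then have "real x * real x \<le> 2 ^ x * 2 ^ x" by (intro mult_mono) auto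
      then have "real x * real x \<le> 4 ^ x" by (simp flip: power_mult_distrib)
      then have "real x * (1 / 4) ^ x \<le> 1 / real x" using x by (simp add: power_divide field_simps)
      then have "real x * (1 / 4) ^ x * (m * S) \<le> 1 / real x * (m * S)" using mS by (rule mult_right_mono)
      moreover have "real x * (K ^ J / \<rho>) ^ x \<le> \<Lambda> ^ x"
        unfolding \<Lambda>_def power_mult_distrib using x2 \<Lambda> by (intro mult_right_mono) auto
      then have "2 * \<epsilon> * (real x * (K ^ J / \<rho>) ^ x) \<le> 2 * \<epsilon> * \<Lambda> ^ x" using \<epsilon> by (intro mult_left_mono) auto
      ultimately have "real x * E \<le> m * S / real x + 2 * (\<epsilon> * \<Lambda> ^ x)"
        by (simp add: E_def algebra_simps)
      then show ?thesis using d0 by (simp add: divide_right_mono)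
    qed
    also have "\<dots> \<le> C * (1 / real x + \<epsilon> * \<Lambda> ^ x)"
    proof -
      define u where "u = 1 / real x"
      define v where "v = \<epsilon> * \<Lambda> ^ x"
      have uv: "0 \<le> u" "0 \<le> v" using \<epsilon> \<Lambda> by (auto simp: u_def v_def \<Lambda>_def)
      have "m * S * u + 2 * v \<le> (m * S + 2) * (u + v)" using mult_nonneg_nonneg[OF mS uv(2)] uv by (simp add: algebra_simps)
      then have "(m * S * u + 2 * v) / d0 \<le> (m * S + 2) * (u + v) / d0" using d0 by (intro divide_right_mono) auto
      moreover have "m * u \<le> m * (u + v)" using uv m by simp
      ultimately have "(m * S * u + 2 * v) / d0 + m * u \<le> (m * S + 2) * (u + v) / d0 + m * (u + v)"
        by (rule add_mono)
      then have "2 * ((m * S * u + 2 * v) / d0 + m * u) \<le> 2 * ((m * S + 2) * (u + v) / d0 + m * (u + v))"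
        by (rule mult_left_mono) simp
      also have "\<dots> = C * (u + v)" by (simp add: C_def algebra_simps add_divide_distrib)
      finally have "2 * ((m * S * u + 2 * v) / d0 + m * u) \<le> C * (u + v)" .
      then show ?thesis by (simp add: u_def v_def)
    qed
    finally show ?thesis by (simp add: x_def)
  qed
  moreover have "0 < C" using mS d0 m by (simp add: C_def add_nonneg_pos)
  moreover have "1 < \<Lambda>" using \<Lambda> unfolding \<Lambda>_def by linarith
  ultimately show ?thesis by blast
qed

section \<open>Balancing the cutoff against the data\<close>

text \<open>For small \<open>\<epsilon>\<close>, \<open>N\<^sup>2\<close> is taken of order
  \<open>\<bar>ln \<epsilon>\<bar> / (2 * ln \<Lambda>)\<close>, so that
  \<open>\<Lambda> ^ N\<^sup>2\<close> uses up at most the square root of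
  \<open>1 / \<epsilon>\<close>. Otherwise \<open>N = 1\<close> suffices.\<close>

lemma optimize_frequency_cutoff:
  fixes C \<Lambda> l \<epsilon> :: real
  assumes C: "0 < C" "1 < \<Lambda>" and \<epsilon>: "0 < \<epsilon>"
    and l: "\<And>N. 1 \<le> N \<Longrightarrow> l \<le> C * (1 / (real N)\<^sup>2 + \<epsilon> * \<Lambda> ^ N\<^sup>2)"
  shows "l \<le> C * (exp (2 * ln \<Lambda>) + \<Lambda> + 8 * ln \<Lambda> + 2) * (inverse \<bar>ln \<epsilon>\<bar> + \<epsilon>)"
proof -
  define a where "a = ln \<Lambda>"
  define D where "D = exp (2 * a) + \<Lambda> + 8 * a + 2"
  have a: "0 < a" "\<Lambda> = exp a" using C by (auto simp: a_def)
  have D: "exp (2 * a) + \<Lambda> \<le> D" "8 * a + 2 \<le> D" "0 \<le> D" using a C by (auto simp: D_def)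
  have "l \<le> C * (D * (inverse \<bar>ln \<epsilon>\<bar> + \<epsilon>))"
  proof (cases "exp (- 2 * a) \<le> \<epsilon>")
    \<comment> \<open>Here \<open>\<epsilon>\<close> is bounded below and the summand
      \<open>\<epsilon>\<close> on the right alone is enough. This includes
      \<open>\<epsilon> = 1\<close>, where the real \<open>inverse \<bar>ln \<epsilon>\<bar>\<close>
      is 0.\<close>
    case True
    have "1 = exp (2 * a) * exp (- 2 * a)" by (simp flip: exp_add)
    also have "\<dots> \<le> exp (2 * a) * \<epsilon>" using True by (intro mult_left_mono) auto
    finally have "1 + \<epsilon> * \<Lambda> \<le> (exp (2 * a) + \<Lambda>) * \<epsilon>" by (simp add: algebra_simps)
    also have "\<dots> \<le> D * (inverse \<bar>ln \<epsilon>\<bar> + \<epsilon>)" using D \<epsilon> by (intro mult_mono) auto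
    finally have "C * (1 + \<epsilon> * \<Lambda>) \<le> C * (D * (inverse \<bar>ln \<epsilon>\<bar> + \<epsilon>))" using C by simp
    then show ?thesis using l[of 1] by simp
  next
    case False
    define y where "y = - ln \<epsilon>"
    have "\<epsilon> = exp (- y)" using \<epsilon> by (simp add: y_def)
    then have y: "2 * a < y" "0 < y" "\<epsilon> = exp (- y)" using False a by auto
    \<comment> \<open>The real-valued choice of the cutoff. Since \<open>s \<ge> 1\<close>, rounding
      down loses at most a factor 2, whence \<open>8 * a / y\<close>.\<close>
    define s where "s = sqrt (y / (2 * a))"
    have s: "1 \<le> s" "s\<^sup>2 = y / (2 * a)" using y a by (auto simp: s_def)
    define N where "N = nat \<lfloor>s\<rfloor>"
    have N: "1 \<le> N" "real N \<le> s" "s \<le> 2 * real N"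
    proof -
      have "1 \<le> \<lfloor>s\<rfloor>" using s(1) by simp
      then have "1 \<le> N" "real N = of_int \<lfloor>s\<rfloor>" unfolding N_def by linarith+
      then show "1 \<le> N" "real N \<le> s" "s \<le> 2 * real N" by linarith+
    qed
    have "s\<^sup>2 \<le> (2 * real N)\<^sup>2" using N s by (intro power_mono) auto
    then have 1: "1 / (real N)\<^sup>2 \<le> 8 * a / y"
      using N y a unfolding s(2) by (simp add: field_simps power2_eq_square)
    have "a * (real N)\<^sup>2 \<le> a * s\<^sup>2" using N a by (intro mult_left_mono power_mono) auto
    also have "\<dots> = y / 2" using a by (simp add: s(2))
    finally have "a * (real N)\<^sup>2 - y \<le> - (y / 2)" by simp
    moreover have "\<epsilon> * \<Lambda> ^ N\<^sup>2 = exp (a * (real N)\<^sup>2 - y)"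
      using y by (simp add: a(2) exp_diff exp_minus divide_inverse mult.commute flip: exp_of_nat_mult)
    ultimately have "\<epsilon> * \<Lambda> ^ N\<^sup>2 \<le> inverse (exp (y / 2))" by (simp add: exp_minus[symmetric])
    also have "\<dots> \<le> inverse (y / 2)"
    proof (rule le_imp_inverse_le)
      show "y / 2 \<le> exp (y / 2)" using exp_ge_add_one_self[of "y / 2"] by linarith
    qed (use y(2) in simp)
    also have "\<dots> = 2 * inverse y" unfolding inverse_divide by (rule divide_inverse)
    finally have "1 / (real N)\<^sup>2 + \<epsilon> * \<Lambda> ^ N\<^sup>2 \<le> 8 * a * inverse y + 2 * inverse y"
      using 1 unfolding divide_inverse[of "8 * a"] by linarith
    also have "\<dots> = (8 * a + 2) * inverse y" by (simp only: distrib_right)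
    also have "\<dots> \<le> D * (inverse \<bar>ln \<epsilon>\<bar> + \<epsilon>)"
      using D \<epsilon> y(2) by (intro mult_mono) (auto simp: y_def)
    finally have "C * (1 / (real N)\<^sup>2 + \<epsilon> * \<Lambda> ^ N\<^sup>2) \<le> C * (D * (inverse \<bar>ln \<epsilon>\<bar> + \<epsilon>))" using C by simp
    then show ?thesis using l[OF N(1)] by simp
  qed
  then show ?thesis by (simp add: D_def a_def mult.assoc)
qed

theorem theorem3p1:
  fixes B :: "real set" and x0 m :: real
  assumes "x0 \<in> {0<..<pi}"
    and "\<exists>d0>0. \<forall>k::nat. k \<ge> 1 \<longrightarrow> \<bar>sin (real k * x0)\<bar> \<ge> d0 * inverse (real k)"
    and "\<exists>T>0. B \<subseteq> {0..T}"
    and "B \<in> sets lebesgue"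
    and "emeasure lebesgue B > 0"
    and "m > 0"
  shows "\<exists>C>0. \<forall>f. H_fun 2 f \<and> H_norm 2 f \<le> m \<longrightarrow>
    ennreal (L2_norm f) \<le>
      ennreal C * (inv_abs_ln (Linf_norm B (heat_sol f x0)) + Linf_norm B (heat_sol f x0))"
proof -
  obtain d0 where d0: "0 < d0" "\<And>k::nat. 1 \<le> k \<Longrightarrow> d0 * inverse (real k) \<le> \<bar>sin (real k * x0)\<bar>"
    using assms(2) by blast
  obtain T where T: "B \<subseteq> {0..T}" using assms(3) by blast
  obtain C \<Lambda> where C: "0 < C" "1 < \<Lambda>" and
    cutoff: "\<And>f \<epsilon> N. \<lbrakk>H_fun 2 f; H_norm 2 f \<le> m; 0 \<le> \<epsilon>;
      AE t in lebesgue_on B. norm (heat_sol f x0 t) \<le> \<epsilon>; 1 \<le> N\<rbrakk> \<Longrightarrow>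
      L2_norm f \<le> C * (1 / (real N)\<^sup>2 + \<epsilon> * \<Lambda> ^ N\<^sup>2)"
    using L2_norm_le_frequency_cutoff[OF d0 T assms(4-6)] by blast
  define C' where "C' = C * (exp (2 * ln \<Lambda>) + \<Lambda> + 8 * ln \<Lambda> + 2)"
  have C': "0 < C'" using C by (simp add: C'_def add_pos_pos)
  have "ennreal (L2_norm f) \<le> ennreal C' *
      (inv_abs_ln (Linf_norm B (heat_sol f x0)) + Linf_norm B (heat_sol f x0))"
    if f: "H_fun 2 f" "H_norm 2 f \<le> m" for f
  proof (cases "Linf_norm B (heat_sol f x0)")
    case top
    then show ?thesis using C' by (simp add: ennreal_mult_top)
  next
    case (real \<epsilon>)
    have "AE t in lebesgue_on B. ennreal (norm (heat_sol f x0 t)) \<le> Linf_norm B (heat_sol f x0)"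
      unfolding Linf_norm_def by (rule esssup_AE)
    then have "AE t in lebesgue_on B. norm (heat_sol f x0 t) \<le> \<epsilon>"
      using real by simp
    note cut = cutoff[OF f real(1) this]
    show ?thesis
    \<comment> \<open>These are the values at which \<open>inv_abs_ln\<close> follows a convention.
      At 1 the right-hand side is infinite; at 0 it is 0, so \<open>f\<close> must have norm
      0.\<close>
    proof (cases "\<epsilon> = 0 \<or> \<epsilon> = 1")
      case False
      then have \<epsilon>: "0 < \<epsilon>" "\<epsilon> \<noteq> 1" using real by auto
      then have "inv_abs_ln (Linf_norm B (heat_sol f x0)) = ennreal (inverse \<bar>ln \<epsilon>\<bar>)"
        by (simp add: inv_abs_ln_def real(2))
      moreover have "L2_norm f \<le> C' * (inverse \<bar>ln \<epsilon>\<bar> + \<epsilon>)"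
        unfolding C'_def by (rule optimize_frequency_cutoff[OF C \<epsilon>(1) cut])
      ultimately show ?thesis
        using C' \<epsilon> by (simp add: real(2) ennreal_leI flip: ennreal_mult ennreal_plus)
    next
      case True
      then show ?thesis
      proof
        assume "\<epsilon> = 1"
        then show ?thesis using C' by (simp add: real(2) inv_abs_ln_def ennreal_mult_top)
      next
        assume e0: "\<epsilon> = 0"
        \<comment> \<open>With vanishing data the cutoff estimate reduces to
          \<open>C / (real N)\<^sup>2\<close> for every \<open>N\<close>, and \<open>N\<close> tends
          to infinity.\<close>
        have "(\<lambda>N. C * (inverse (real N))\<^sup>2) \<longlonglongrightarrow> C * 0\<^sup>2"
          by (intro tendsto_intros lim_inverse_n)
        moreover have "\<forall>N\<ge>1. L2_norm f \<le> C * (inverse (real N))\<^sup>2"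
          using cut by (simp add: e0 power_inverse divide_inverse)
        ultimately have "L2_norm f \<le> 0"
          using LIMSEQ_le_const[of "\<lambda>N. C * (inverse (real N))\<^sup>2" 0 "L2_norm f"] by auto
        then show ?thesis by (simp add: ennreal_neg)
      qed
    qed
  qed
  then show ?thesis using C' by blast
qed

end
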